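(* There is an absolute constant $\kappa>0$ such that for all integers $k\ge2$, $n\ge1$ and all $\delta>0$, if $\mathsf{C}\colon\{0,1\}^k\to\{0,1\}^n$ is a linear $3$-query locally decodable code with parameter $\delta$ (a $(3,\delta)$-linear LDC), then $$n\ \ge\ \kappa\cdot\frac{\delta^6k^3}{\log^4k}.$$
   Context: A $q$-uniform hypergraph matching on $[n]$ is a collection of pairwise disjoint subsets of $[n]$, each of size exactly $q$. A code $\mathsf{C}\colon\{0,1\}^k\to\{0,1\}^n$ is a $(q,\delta)$-linear LDC if $\mathsf{C}$ is linear (as a map over $\mathbb{F}_2$) and there are $q$-uniform hypergraph matchings $\mathcal{H}_1,\dots,\mathcal{H}_k$ on $[n]$ such that (1) $|\mathcal{H}_i|\ge\delta n$ for every $i\in[k]$, and (2) for every $i\in[k]$ and every $C\in\mathcal{H}_i$, $\bigoplus_{v\in C}\mathsf{C}(b)_v=b_i$ for all $b\in\{0,1\}^k$. *)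

theory Defs
  imports Complex_Main "HOL-Library.Z2" "Jordan_Normal_Form.Matrix"
begin

text \<open>
  Index sets are zero-based: \<open>[n]\<close> is \<^term>\<open>{..<n}\<close>, and
  \<open>{0,1}\<^sup>n\<close> is \<^term>\<open>carrier_vec n :: bit vec set\<close>, where \<^typ>\<open>bit\<close> is the field
  with two elements.
\<close>

definition hypergraph_matching :: "nat \<Rightarrow> nat \<Rightarrow> nat set set \<Rightarrow> bool" where
  "hypergraph_matching q n H \<longleftrightarrow>
     (\<forall>e\<in>H. e \<subseteq> {..<n} \<and> card e = q) \<and> pairwise disjnt H"

definition linear_code :: "nat \<Rightarrow> nat \<Rightarrow> (bit vec \<Rightarrow> bit vec) \<Rightarrow> bool" where
  "linear_code k n C \<longleftrightarrow>
     C \<in> carrier_vec k \<rightarrow> carrier_vec n \<and>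
     (\<forall>x\<in>carrier_vec k. \<forall>y\<in>carrier_vec k. C (x + y) = C x + C y) \<and>
     (\<forall>a. \<forall>x\<in>carrier_vec k. C (a \<cdot>\<^sub>v x) = a \<cdot>\<^sub>v C x)"

text \<open>The sum over \<open>e\<close> below is taken in \<^typ>\<open>bit\<close>, so it is the exclusive or.\<close>

definition linear_LDC :: "nat \<Rightarrow> real \<Rightarrow> nat \<Rightarrow> nat \<Rightarrow> (bit vec \<Rightarrow> bit vec) \<Rightarrow> bool" where
  "linear_LDC q \<delta> k n C \<longleftrightarrow>
     linear_code k n C \<and>
     (\<exists>H :: nat \<Rightarrow> nat set set.
        (\<forall>i<k. hypergraph_matching q n (H i)) \<and>
        (\<forall>i<k. real (card (H i)) \<ge> \<delta> * real n) \<and>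
        (\<forall>i<k. \<forall>e\<in>H i. \<forall>b\<in>carrier_vec k. (\<Sum>v\<in>e. C b $ v) = b $ i))"

end

theory Submission
  imports Defs "HOL-Analysis.Convex" "HOL-Library.FuncSet"
begin

text \<open>
  Let \<open>c v\<close> be the vector with \<open>C(b)\<^sub>v = \<langle>c v, b\<rangle>\<close>, so that \<open>c x + c y + c z = e\<^sub>i\<close> for every triple of
  the \<open>i\<close>-th matching. If many triples contain a pair of large codegree, these pairs are treated as new
  coordinates and yield a linear 2-query code, which is impossible by the edge isoperimetric
  inequality of the cube. Otherwise two triples \<open>{x, u, x'}\<close> and \<open>{u, y, y'}\<close> of colours \<open>j > i\<close> that
  share \<open>u\<close> give \<open>c x + c x' + c y + c y' = e\<^sub>j + e\<^sub>i\<close>. They define a Kikuchi-type graph on pairs of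
  \<open>l\<close>-tuples of coordinates: replace one entry \<open>x\<close> of the first tuple by \<open>x'\<close> and one entry \<open>y\<close> of the
  second by \<open>y'\<close>. A second moment bound shows that most edges of each colour \<open>j\<close> avoid vertices of
  large degree, hence carry a large fractional matching, and the isoperimetric inequality, in a form
  that only looks at the top coordinate in which the endpoints differ, bounds the number of edges.
  Taking \<open>l\<close> of order \<open>sqrt (n d / k)\<close>, with \<open>d\<close> of order \<open>log n / \<delta>\<close> the codegree
  threshold, gives the theorem.
\<close>

section \<open>Edge isoperimetry in the cube\<close>

text \<open>For \<open>0 < a\<close>, moving the first two terms to the right leaves
  \<open>b * log 2 (1 + a / b) + a * log 2 (1 + b / a)\<close>, and each summand is at least
  \<open>a\<close>. The term \<open>2 * a\<close> will pay for the pairs, in both orders, between a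
  half of size \<open>a\<close> and one of size \<open>b\<close>.\<close>

lemma xlog_superadditive:
  fixes a b :: real
  assumes "0 \<le> a" "a \<le> b"
  shows "a * log 2 a + b * log 2 b + 2 * a \<le> (a + b) * log 2 (a + b)"
proof (cases "a = 0")
  case False
  with assms have ab: "0 < a" "0 < b" by auto
  define x where "x = a / b"
  have x: "0 \<le> x" "x \<le> 1" using ab assms by (auto simp: x_def)
  \<comment> \<open>Convexity puts \<open>2 powr x\<close> below its chord on the unit interval,
    which yields \<open>x \<le> log 2 (1 + x)\<close>.\<close>
  have cvx: "convex_on UNIV (\<lambda>x::real. exp (x * ln 2))"
  proof -
    have "exp (((1 - t) * u + t * v) * ln 2) \<le> (1 - t) * exp (u * ln 2) + t * exp (v * ln 2)"
      if "0 < t" "t < 1" for t u v :: real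
      using convex_onD[OF exp_convex, of t "u * ln 2" "v * ln 2"] that by (simp add: algebra_simps)
    then show ?thesis by (intro convex_onI) (auto simp: algebra_simps)
  qed
  have "exp (x * ln 2) \<le> 1 + x"
    using convex_onD[OF cvx x, of 0 1] by (simp add: algebra_simps)
  then have "x * ln 2 \<le> ln (1 + x)"
    using x by (subst ln_ge_iff) auto
  then have "x \<le> log 2 (1 + x)" by (simp add: log_def field_simps)
  then have *: "a \<le> b * log 2 (1 + a / b)" using ab by (simp add: x_def field_simps)
  have "log 2 2 \<le> log 2 (1 + b / a)" using ab assms by (subst log_le_cancel_iff) (auto simp: field_simps add_pos_pos)
  then have **: "a \<le> a * log 2 (1 + b / a)" using ab by simp
  have "log 2 (1 + a / b) = log 2 (a + b) - log 2 b" "log 2 (1 + b / a) = log 2 (a + b) - log 2 a"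
    using ab by (simp_all add: log_divide_pos[symmetric] add_divide_distrib add.commute)
  with * ** show ?thesis by (simp add: algebra_simps)
qed simp

text \<open>\<open>W j\<close> is a fractional matching of pairs whose top differing coordinate is \<open>j\<close>.\<close>

lemma weighted_edge_isoperimetry:
  fixes W :: "nat \<Rightarrow> 'v \<Rightarrow> 'v \<Rightarrow> real" and \<phi> :: "'v \<Rightarrow> nat \<Rightarrow> bool"
  assumes "finite V"
    and "\<And>j u v. 0 \<le> W j u v"
    and "\<And>j u. j < k \<Longrightarrow> u \<in> V \<Longrightarrow> (\<Sum>v\<in>V. W j u v) \<le> 1"
    and "\<And>j v. j < k \<Longrightarrow> v \<in> V \<Longrightarrow> (\<Sum>u\<in>V. W j u v) \<le> 1"
    and "\<And>j u v. j < k \<Longrightarrow> u \<in> V \<Longrightarrow> v \<in> V \<Longrightarrow> W j u v \<noteq> 0 \<Longrightarrow>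
           \<phi> u j \<noteq> \<phi> v j \<and> (\<forall>i. j < i \<longrightarrow> i < k \<longrightarrow> \<phi> u i = \<phi> v i)"
  shows "(\<Sum>j<k. \<Sum>u\<in>V. \<Sum>v\<in>V. W j u v) \<le> real (card V) * log 2 (real (card V))"
  using assms
proof (induction k arbitrary: V)
  case 0
  have "0 \<le> log 2 (real (card V))" if "card V \<noteq> 0"
    using that by simp
  then show ?case by (cases "card V = 0") auto
next
  case (Suc k)
  note fin = Suc.prems(1) and nn = Suc.prems(2) and row = Suc.prems(3) and col = Suc.prems(4) and sep = Suc.prems(5)
  \<comment> \<open>The vertices are halved along the top coordinate \<open>k\<close>. Pairs of a
    colour below \<open>k\<close> agree there and stay inside a half; pairs of colour
    \<open>k\<close> all cross. Vertices may share a label \<open>\<phi>\<close>, since only their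
    number enters.\<close>
  define A where "A = {v \<in> V. \<phi> v k}"
  define B where "B = {v \<in> V. \<not> \<phi> v k}"
  have V: "V = A \<union> B" "A \<inter> B = {}" and fAB: "finite A" "finite B" 
    using fin by (auto simp: A_def B_def)
  have split: "(\<Sum>u\<in>V. \<Sum>v\<in>V. h u v) = (\<Sum>u\<in>A. \<Sum>v\<in>A. h u v) + (\<Sum>u\<in>B. \<Sum>v\<in>B. h u v)
      + (\<Sum>u\<in>A. \<Sum>v\<in>B. h u v) + (\<Sum>u\<in>B. \<Sum>v\<in>A. h u v)" for h :: "'v \<Rightarrow> 'v \<Rightarrow> real"
    using V fAB by (simp add: sum.union_disjoint sum.distrib)
  have IH: "(\<Sum>j<k. \<Sum>u\<in>U. \<Sum>v\<in>U. W j u v) \<le> real (card U) * log 2 (real (card U))"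
    if "U \<subseteq> V" for U
  proof (rule Suc.IH)
    show "finite U" using that fin by (rule finite_subset)
    show "0 \<le> W j u v" for j u v by (rule nn)
    show "(\<Sum>v\<in>U. W j u v) \<le> 1" if "j < k" "u \<in> U" for j u
      using row[of j u] sum_mono2[OF fin \<open>U \<subseteq> V\<close>, of "W j u"] nn that \<open>U \<subseteq> V\<close> by fastforce
    show "(\<Sum>u\<in>U. W j u v) \<le> 1" if "j < k" "v \<in> U" for j v
      using col[of j v] sum_mono2[OF fin \<open>U \<subseteq> V\<close>, of "\<lambda>u. W j u v"] nn that \<open>U \<subseteq> V\<close> by fastforce
    show "\<phi> u j \<noteq> \<phi> v j \<and> (\<forall>i. j < i \<longrightarrow> i < k \<longrightarrow> \<phi> u i = \<phi> v i)"
      if "j < k" "u \<in> U" "v \<in> U" "W j u v \<noteq> 0" for j u v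
      using sep[of j u v] that \<open>U \<subseteq> V\<close> by (auto dest: subsetD less_SucI)
  qed
  have low: "(\<Sum>u\<in>V. \<Sum>v\<in>V. W j u v) = (\<Sum>u\<in>A. \<Sum>v\<in>A. W j u v) + (\<Sum>u\<in>B. \<Sum>v\<in>B. W j u v)"
    if "j < k" for j
  proof -
    have "W j u v = 0" if "u \<in> A \<and> v \<in> B \<or> u \<in> B \<and> v \<in> A" for u v
      using sep[of j u v] that \<open>j < k\<close> unfolding A_def B_def by auto
    then show ?thesis unfolding split by simp
  qed
  have "W k u v = 0" if "u \<in> A \<and> v \<in> A \<or> u \<in> B \<and> v \<in> B" for u v
    using sep[of k u v] that unfolding A_def B_def by auto
  then have top: "(\<Sum>u\<in>V. \<Sum>v\<in>V. W k u v) = (\<Sum>u\<in>A. \<Sum>v\<in>B. W k u v) + (\<Sum>u\<in>B. \<Sum>v\<in>A. W k u v)"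
    unfolding split by simp
  \<comment> \<open>A fractional matching between two sets weighs at most the size of either: rows
    give one bound, columns the other.\<close>
  have cross: "(\<Sum>u\<in>P. \<Sum>v\<in>Q. W k u v) \<le> real (min (card P) (card Q))"
    if "P \<subseteq> V" "Q \<subseteq> V" for P Q
  proof -
    have "(\<Sum>v\<in>Q. W k u v) \<le> 1" if "u \<in> P" for u
      using row[of k u] sum_mono2[OF fin \<open>Q \<subseteq> V\<close>, of "W k u"] nn that \<open>P \<subseteq> V\<close> by fastforce
    then have 1: "(\<Sum>u\<in>P. \<Sum>v\<in>Q. W k u v) \<le> real (card P)"
      using sum_mono[of P "\<lambda>u. \<Sum>v\<in>Q. W k u v" "\<lambda>_. 1"] by simp
    have "(\<Sum>u\<in>P. W k u v) \<le> 1" if "v \<in> Q" for v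
      using col[of k v] sum_mono2[OF fin \<open>P \<subseteq> V\<close>, of "\<lambda>u. W k u v"] nn that \<open>Q \<subseteq> V\<close> by fastforce
    then have "(\<Sum>v\<in>Q. \<Sum>u\<in>P. W k u v) \<le> real (card Q)"
      using sum_mono[of Q "\<lambda>v. \<Sum>u\<in>P. W k u v" "\<lambda>_. 1"] by simp
    with 1 show ?thesis by (subst (asm) (2) sum.swap) simp
  qed
  have "(\<Sum>u\<in>V. \<Sum>v\<in>V. W k u v) \<le> 2 * real (min (card A) (card B))"
    using cross[of A B] cross[of B A] V unfolding top by (simp add: min.commute)
  moreover have "(\<Sum>j<k. \<Sum>u\<in>V. \<Sum>v\<in>V. W j u v)
      \<le> real (card A) * log 2 (real (card A)) + real (card B) * log 2 (real (card B))"
    using IH[of A] IH[of B] by (simp add: low sum.distrib A_def B_def)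
  moreover have "card V = card A + card B"
    using V fAB by (simp add: card_Un_disjoint)
  ultimately show ?case
    using xlog_superadditive[of "real (card A)" "real (card B)"]
      xlog_superadditive[of "real (card B)" "real (card A)"]
    by (cases "card A \<le> card B") (auto simp: algebra_simps min_def)
qed

section \<open>From a second moment bound to a fractional matching\<close>

text \<open>By \<open>mom\<close> and Markov's inequality, vertices of degree above
  \<open>4 * \<Lambda>\<close> carry at most a quarter of the total degree of a colour. Dropping the
  edges with such a vertex at either end keeps at least half, and division by
  \<open>4 * \<Lambda>\<close> turns the rest into a fractional matching; hence the factor
  \<open>8\<close>.\<close>

lemma degree_sum_le:
  fixes B :: "nat \<Rightarrow> 'v \<Rightarrow> 'v \<Rightarrow> real" and \<phi> :: "'v \<Rightarrow> nat \<Rightarrow> bool" and \<Lambda> :: real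
  defines "D \<equiv> \<lambda>V j u. \<Sum>v\<in>V. B j u v"
  assumes fin: "finite V" and \<Lambda>: "0 < \<Lambda>"
    and nn: "\<And>j u v. 0 \<le> B j u v"
    and sym: "\<And>j u v. B j u v = B j v u"
    and sep: "\<And>j u v. j < k \<Longrightarrow> u \<in> V \<Longrightarrow> v \<in> V \<Longrightarrow> B j u v \<noteq> 0 \<Longrightarrow>
           \<phi> u j \<noteq> \<phi> v j \<and> (\<forall>i. j < i \<longrightarrow> i < k \<longrightarrow> \<phi> u i = \<phi> v i)"
    and mom: "\<And>j. j < k \<Longrightarrow> (\<Sum>u\<in>V. (D V j u)\<^sup>2) \<le> \<Lambda> * (\<Sum>u\<in>V. D V j u)"
  shows "(\<Sum>j<k. \<Sum>u\<in>V. D V j u) \<le> 8 * \<Lambda> * (real (card V) * log 2 (real (card V)))"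
proof -
  define K where "K = 4 * \<Lambda>"
  have K: "0 < K" using \<Lambda> by (simp add: K_def)
  define good :: "nat \<Rightarrow> 'v \<Rightarrow> real" where "good j u = of_bool (D V j u \<le> K)" for j u
  have good: "0 \<le> good j u" "good j u \<le> 1" for j u by (auto simp: good_def)
  define W where "W j u v = good j u * good j v * B j u v / K" for j u v
  have D0: "0 \<le> D V j u" for j u unfolding D_def by (intro sum_nonneg nn)
  have Wsym: "W j u v = W j v u" for j u v by (simp add: W_def sym[of j u v])
  have row: "(\<Sum>v\<in>V. W j u v) \<le> 1" for j u
  proof -
    have "(\<Sum>v\<in>V. W j u v) \<le> (\<Sum>v\<in>V. good j u * B j u v / K)"
      unfolding W_def using good nn K
      by (intro sum_mono divide_right_mono mult_right_mono) (auto intro: mult_left_le)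
    also have "\<dots> = good j u * D V j u / K"
      by (simp add: D_def sum_distrib_left sum_divide_distrib)
    also have "\<dots> \<le> 1" using K by (simp add: good_def)
    finally show ?thesis .
  qed
  have tot: "(\<Sum>u\<in>V. D V j u) \<le> 8 * \<Lambda> * (\<Sum>u\<in>V. \<Sum>v\<in>V. W j u v)" if "j < k" for j
  proof -
    \<comment> \<open>Only vertices of degree above \<open>K\<close> contribute, and there the
      degree is at most its square divided by \<open>K\<close>.\<close>
    have "(1 - good j u) * D V j u \<le> (D V j u)\<^sup>2 / K" for u
      using K D0[of j u] mult_right_mono[of K "D V j u" "D V j u"]
      by (auto simp: good_def field_simps power2_eq_square)
    then have "(\<Sum>u\<in>V. (1 - good j u) * D V j u) \<le> (\<Sum>u\<in>V. (D V j u)\<^sup>2) / K"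
      unfolding sum_divide_distrib by (rule sum_mono)
    also have "\<dots> \<le> \<Lambda> * (\<Sum>u\<in>V. D V j u) / K"
      using mom[OF that] K by (intro divide_right_mono) auto
    also have "\<dots> = (\<Sum>u\<in>V. D V j u) / 4" using \<Lambda> by (simp add: K_def)
    finally have bad: "(\<Sum>u\<in>V. (1 - good j u) * D V j u) \<le> (\<Sum>u\<in>V. D V j u) / 4" .
    have 1: "(\<Sum>u\<in>V. (1 - good j u) * D V j u) = (\<Sum>u\<in>V. \<Sum>v\<in>V. (1 - good j u) * B j u v)"
      by (simp add: D_def sum_distrib_left)
    \<comment> \<open>Symmetry of \<open>B\<close> makes the weight lost at bad second ends equal to
      that lost at bad first ends.\<close>
    have 2: "(\<Sum>u\<in>V. (1 - good j u) * D V j u) = (\<Sum>u\<in>V. \<Sum>v\<in>V. (1 - good j v) * B j u v)"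
      unfolding 1 by (subst sum.swap) (simp add: sym)
    \<comment> \<open>Inclusion-exclusion: an edge with two bad ends is subtracted twice, so the
      left side can only be too small.\<close>
    have "B j u v - (1 - good j u) * B j u v - (1 - good j v) * B j u v \<le> K * W j u v" for u v
    proof -
      have "0 \<le> (1 - good j u) * (1 - good j v) * B j u v" using good nn by simp
      then show ?thesis using K by (simp add: W_def algebra_simps)
    qed
    then have "(\<Sum>u\<in>V. \<Sum>v\<in>V. B j u v - (1 - good j u) * B j u v - (1 - good j v) * B j u v)
        \<le> K * (\<Sum>u\<in>V. \<Sum>v\<in>V. W j u v)"
      unfolding sum_distrib_left by (intro sum_mono)
    then have "(\<Sum>u\<in>V. D V j u) - 2 * (\<Sum>u\<in>V. (1 - good j u) * D V j u)
        \<le> K * (\<Sum>u\<in>V. \<Sum>v\<in>V. W j u v)"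
      using 1 2 unfolding sum_subtractf by (simp add: D_def)
    with bad show ?thesis by (simp add: K_def)
  qed
  have "(\<Sum>j<k. \<Sum>u\<in>V. \<Sum>v\<in>V. W j u v) \<le> real (card V) * log 2 (real (card V))"
  proof (rule weighted_edge_isoperimetry[where \<phi> = \<phi>, OF fin])
    show "0 \<le> W j u v" for j u v using good nn K by (simp add: W_def)
    show "(\<Sum>u\<in>V. W j u v) \<le> 1" for j v using row[of j v] by (simp add: Wsym[of j _ v])
    show "\<phi> u j \<noteq> \<phi> v j \<and> (\<forall>i. j < i \<longrightarrow> i < k \<longrightarrow> \<phi> u i = \<phi> v i)"
      if "j < k" "u \<in> V" "v \<in> V" "W j u v \<noteq> 0" for j u v
      using sep[of j u v] that by (auto simp: W_def)
  qed (rule row)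
  then have "8 * \<Lambda> * (\<Sum>j<k. \<Sum>u\<in>V. \<Sum>v\<in>V. W j u v) \<le> 8 * \<Lambda> * (real (card V) * log 2 (real (card V)))"
    using \<Lambda> by (intro mult_left_mono) auto
  moreover have "(\<Sum>j<k. \<Sum>u\<in>V. D V j u) \<le> 8 * \<Lambda> * (\<Sum>j<k. \<Sum>u\<in>V. \<Sum>v\<in>V. W j u v)"
    unfolding sum_distrib_left[of "8 * \<Lambda>" _ "{..<k}"] by (rule sum_mono) (use tot in auto)
  ultimately show ?thesis by linarith
qed

section \<open>The Kikuchi graph on pairs of tuples\<close>

text \<open>Real-valued, so that it can be a factor of an edge weight. The entries at
  \<open>s\<close> are unconstrained and may coincide.\<close>

definition agree_off :: "nat \<Rightarrow> nat \<Rightarrow> (nat \<Rightarrow> 'a) \<Rightarrow> (nat \<Rightarrow> 'a) \<Rightarrow> real" where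
  "agree_off l s f g = of_bool (\<forall>r<l. r \<noteq> s \<longrightarrow> g r = f r)"

lemma agree_off_nonneg [simp]: "0 \<le> agree_off l s f g"
  by (simp add: agree_off_def)

lemma agree_off_sym: "agree_off l s f g = agree_off l s g f"
  unfolding agree_off_def by (rule arg_cong[where f = of_bool]) metis

text \<open>The tuples that agree with \<open>f\<close> off \<open>s\<close> are exactly
  \<open>f(s := x)\<close> for \<open>x \<in> X\<close>, so only the choice of the new entry
  remains.\<close>

lemma sum_agree_off:
  assumes "finite X" "f \<in> {..<l} \<rightarrow>\<^sub>E X" "s < l"
  shows "(\<Sum>g\<in>{..<l} \<rightarrow>\<^sub>E X. agree_off l s f g * h (g s)) = (\<Sum>x\<in>X. h x)"
proof -
  let ?F = "{..<l} \<rightarrow>\<^sub>E X"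
  have fin: "finite ?F" by (intro finite_PiE) (auto simp: assms)
  have "(\<Sum>g\<in>?F. agree_off l s f g * h (g s)) = (\<Sum>g\<in>{g\<in>?F. \<forall>r<l. r \<noteq> s \<longrightarrow> g r = f r}. h (g s))"
    using fin by (simp add: agree_off_def sum.If_cases of_bool_def if_distrib[of "\<lambda>x. x * _"] Int_def cong: if_cong)
  also have "\<dots> = (\<Sum>x\<in>X. h x)"
  proof (rule sum.reindex_bij_witness[where j = "\<lambda>g. g s" and i = "\<lambda>x. f(s := x)"])
    fix g assume g: "g \<in> {g\<in>?F. \<forall>r<l. r \<noteq> s \<longrightarrow> g r = f r}"
    show "f(s := g s) = g"
    proof
      fix r show "(f(s := g s)) r = g r"
        using g assms(2) by (cases "r < l") (auto simp: PiE_def extensional_def)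
    qed
    show "g s \<in> X" using g assms(3) by (auto simp: PiE_def)
  next
    fix x assume "x \<in> X"
    then show "f(s := x) \<in> {g\<in>?F. \<forall>r<l. r \<noteq> s \<longrightarrow> g r = f r}"
      using assms(2,3) by (auto simp: PiE_def extensional_def)
  qed auto
  finally show ?thesis .
qed

text \<open>Resampling: entry \<open>s\<close> of a uniform tuple is independent of the others, so a
  fresh uniform \<open>x\<close> may replace it; the range of \<open>x\<close> gives the factor
  \<open>card X\<close>. Formally, pairs of tuples that agree off \<open>s\<close> are counted from
  both ends.\<close>

lemma sum_PiE_coordinate:
  fixes h :: "(nat \<Rightarrow> 'a) \<Rightarrow> 'a \<Rightarrow> real"
  assumes X: "finite X" and s: "s < l"
    and h: "\<And>f g x. \<forall>r<l. r \<noteq> s \<longrightarrow> f r = g r \<Longrightarrow> h f x = h g x"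
  shows "real (card X) * (\<Sum>f\<in>{..<l} \<rightarrow>\<^sub>E X. h f (f s)) = (\<Sum>f\<in>{..<l} \<rightarrow>\<^sub>E X. \<Sum>x\<in>X. h f x)"
proof -
  let ?F = "{..<l} \<rightarrow>\<^sub>E X"
  have "(\<Sum>f\<in>?F. \<Sum>x\<in>X. h f x) = (\<Sum>f\<in>?F. \<Sum>g\<in>?F. agree_off l s f g * h f (g s))"
    using X s by (simp add: sum_agree_off)
  also have "\<dots> = (\<Sum>f\<in>?F. \<Sum>g\<in>?F. agree_off l s g f * h g (g s))"
  proof (intro sum.cong refl)
    fix f g :: "nat \<Rightarrow> 'a"
    show "agree_off l s f g * h f (g s) = agree_off l s g f * h g (g s)"
      using h[of f g "g s"]
      by (cases "\<forall>r<l. r \<noteq> s \<longrightarrow> f r = g r") (auto simp: agree_off_sym[of l s f g] agree_off_def)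
  qed
  also have "\<dots> = (\<Sum>g\<in>?F. (\<Sum>f\<in>?F. agree_off l s g f * 1) * h g (g s))"
    by (subst sum.swap) (simp add: sum_distrib_right)
  also have "\<dots> = (\<Sum>g\<in>?F. real (card X) * h g (g s))"
    using X s by (intro sum.cong refl) (subst sum_agree_off, auto)
  finally show ?thesis by (simp add: sum_distrib_left)
qed

text \<open>Resample entry \<open>s'\<close>, on which \<open>h (f s)\<close> does not depend: the
  fresh entry gives \<open>h'\<close> a mean of at most \<open>r / card X\<close>.\<close>

lemma sum_PiE_pair_le:
  fixes h h' :: "'a \<Rightarrow> real" and s s' :: nat
  assumes X: "finite X" "X \<noteq> {}" and s: "s < l" "s' < l" "s \<noteq> s'"
    and h: "\<And>x. 0 \<le> h x" and h': "(\<Sum>x\<in>X. h' x) \<le> r"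
  shows "(\<Sum>f\<in>{..<l} \<rightarrow>\<^sub>E X. h (f s) * h' (f s')) \<le> r / real (card X) * (\<Sum>f\<in>{..<l} \<rightarrow>\<^sub>E X. h (f s))"
proof -
  let ?F = "{..<l} \<rightarrow>\<^sub>E X"
  have "real (card X) * (\<Sum>f\<in>?F. h (f s) * h' (f s')) = (\<Sum>f\<in>?F. \<Sum>x\<in>X. h (f s) * h' x)"
    using s X(1) by (intro sum_PiE_coordinate[where h = "\<lambda>f x. h (f s) * h' x"]) auto
  also have "\<dots> = (\<Sum>f\<in>?F. h (f s) * (\<Sum>x\<in>X. h' x))" by (simp add: sum_distrib_left)
  also have "\<dots> \<le> (\<Sum>f\<in>?F. h (f s) * r)" by (intro sum_mono mult_left_mono h h')
  also have "\<dots> = r * (\<Sum>f\<in>?F. h (f s))" by (simp add: sum_distrib_left mult.commute)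
  finally show ?thesis using X by (simp add: field_simps card_gt_0_iff)
qed

lemma sum_swap_pairs:
  "(\<Sum>a\<in>A. \<Sum>b\<in>B. \<Sum>c\<in>C. \<Sum>d\<in>D. h a b c d) = (\<Sum>c\<in>C. \<Sum>d\<in>D. \<Sum>a\<in>A. \<Sum>b\<in>B. h a b c d)"
  unfolding sum.cartesian_product[of _ B A] sum.cartesian_product[of _ D C] case_prod_unfold
  by (rule sum.swap)

text \<open>\<open>degree_sum_le\<close> is applied to the graph on pairs of
  \<open>l\<close>-tuples. With \<open>m = card X\<close>, the mean degree is
  \<open>l^2 / m^2\<close> times the sum of the entries of \<open>A\<close>, while the logarithm of
  the number of vertices is \<open>2 * l * log 2 m\<close>, so one factor \<open>l\<close> is
  gained. The price is \<open>\<Lambda>\<close>, which also grows with \<open>l\<close>.\<close>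

lemma kikuchi_bound:
  fixes \<beta> :: "nat \<Rightarrow> 'a \<Rightarrow> 'a \<Rightarrow> 'a \<Rightarrow> 'a \<Rightarrow> real" and c :: "'a \<Rightarrow> nat \<Rightarrow> bit" and a r :: real
  defines "A \<equiv> \<lambda>X j x y. \<Sum>x'\<in>X. \<Sum>y'\<in>X. \<beta> j x x' y y'"
  assumes X: "finite X" "X \<noteq> {}" and l: "0 < l" and pos: "0 < a" "0 \<le> r"
    and nn: "\<And>j x x' y y'. 0 \<le> \<beta> j x x' y y'"
    and sym: "\<And>j x x' y y'. \<beta> j x x' y y' = \<beta> j x' x y' y"
    and entry: "\<And>j x y. j < k \<Longrightarrow> x \<in> X \<Longrightarrow> y \<in> X \<Longrightarrow> A X j x y \<le> a"
    and row: "\<And>j x. j < k \<Longrightarrow> x \<in> X \<Longrightarrow> (\<Sum>y\<in>X. A X j x y) \<le> r"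
    and col: "\<And>j y. j < k \<Longrightarrow> y \<in> X \<Longrightarrow> (\<Sum>x\<in>X. A X j x y) \<le> r"
    and sep: "\<And>j x x' y y'. j < k \<Longrightarrow> \<beta> j x x' y y' \<noteq> 0 \<Longrightarrow>
        c x j + c x' j + c y j + c y' j = 1 \<and>
        (\<forall>i. j < i \<longrightarrow> i < k \<longrightarrow> c x i + c x' i + c y i + c y' i = 0)"
  shows "real l * (\<Sum>j<k. \<Sum>x\<in>X. \<Sum>y\<in>X. A X j x y)
    \<le> 16 * (a + (real l)\<^sup>2 * r / real (card X)) * (real (card X))\<^sup>2 * log 2 (real (card X))"
proof -
  define F where "F = {..<l} \<rightarrow>\<^sub>E X"
  define m where "m = real (card X)"
  have m: "0 < m" using X by (simp add: m_def card_gt_0_iff)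
  have finF: "finite F" unfolding F_def by (intro finite_PiE) (auto simp: X)
  have cardF: "real (card F) = m ^ l" by (simp add: F_def card_PiE m_def)
  define \<Lambda> where "\<Lambda> = a + (real l)\<^sup>2 * r / m"
  have \<Lambda>: "0 < \<Lambda>" using pos m by (auto simp: \<Lambda>_def intro!: add_pos_nonneg)
  define B where "B j p q = (\<Sum>s<l. \<Sum>t<l. agree_off l s (fst p) (fst q) * agree_off l t (snd p) (snd q) *
      \<beta> j (fst p s) (fst q s) (snd p t) (snd q t))" for j and p q :: "(nat \<Rightarrow> 'a) \<times> (nat \<Rightarrow> 'a)"
  define D where "D j p = (\<Sum>q\<in>F \<times> F. B j p q)" for j p
  have A0: "0 \<le> A X j x y" for j x y unfolding A_def by (intro sum_nonneg nn)
  have D: "D j (f, g) = (\<Sum>s<l. \<Sum>t<l. A X j (f s) (g t))" if "f \<in> F" "g \<in> F" for j f g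
  proof -
    have "D j (f, g) = (\<Sum>f'\<in>F. \<Sum>g'\<in>F. \<Sum>s<l. \<Sum>t<l. agree_off l s f f' *
        (agree_off l t g g' * \<beta> j (f s) (f' s) (g t) (g' t)))"
      by (simp add: D_def B_def sum.cartesian_product' mult.assoc)
    also have "\<dots> = (\<Sum>f'\<in>F. \<Sum>s<l. \<Sum>t<l. agree_off l s f f' *
        (\<Sum>g'\<in>F. agree_off l t g g' * \<beta> j (f s) (f' s) (g t) (g' t)))"
      by (subst sum.swap, intro sum.cong refl, subst sum.swap, simp add: sum_distrib_left)
    also have "\<dots> = (\<Sum>f'\<in>F. \<Sum>s<l. \<Sum>t<l. agree_off l s f f' * (\<Sum>y'\<in>X. \<beta> j (f s) (f' s) (g t) y'))"
      using that X by (simp add: sum_agree_off F_def)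
    also have "\<dots> = (\<Sum>s<l. \<Sum>t<l. \<Sum>f'\<in>F. agree_off l s f f' * (\<Sum>y'\<in>X. \<beta> j (f s) (f' s) (g t) y'))"
      by (subst sum.swap, intro sum.cong refl, subst sum.swap, rule refl)
    also have "\<dots> = (\<Sum>s<l. \<Sum>t<l. A X j (f s) (g t))"
      unfolding A_def F_def
      by (intro sum.cong refl sum_agree_off) (use that X in \<open>auto simp: F_def\<close>)
    finally show ?thesis .
  qed
  have mean: "m\<^sup>2 * (\<Sum>f\<in>F. \<Sum>g\<in>F. A X j (f s) (g t)) = (m ^ l)\<^sup>2 * (\<Sum>x\<in>X. \<Sum>y\<in>X. A X j x y)"
    if "s < l" "t < l" for j s t
  proof -
    have 1: "m * (\<Sum>g\<in>F. h (g s)) = m ^ l * (\<Sum>x\<in>X. h x)" if "s < l" for h :: "'a \<Rightarrow> real" and s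
    proof -
      have "m * (\<Sum>g\<in>F. h (g s)) = (\<Sum>g\<in>F. \<Sum>x\<in>X. h x)"
        unfolding F_def m_def using X(1) that by (rule sum_PiE_coordinate) (rule refl)
      also have "\<dots> = m ^ l * (\<Sum>x\<in>X. h x)"
        unfolding cardF[symmetric] by (rule sum_constant)
      finally show ?thesis .
    qed
    have "m\<^sup>2 * (\<Sum>f\<in>F. \<Sum>g\<in>F. A X j (f s) (g t)) = m * (\<Sum>f\<in>F. m * (\<Sum>g\<in>F. A X j (f s) (g t)))"
      by (simp add: sum_distrib_left power2_eq_square mult.assoc)
    also have "\<dots> = m * (\<Sum>f\<in>F. m ^ l * (\<Sum>y\<in>X. A X j (f s) y))"
    proof (intro arg_cong[where f = "(*) m"] sum.cong refl)
      fix f show "m * (\<Sum>g\<in>F. A X j (f s) (g t)) = m ^ l * (\<Sum>y\<in>X. A X j (f s) y)"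
        by (rule 1[OF that(2)])
    qed
    also have "\<dots> = m ^ l * (m * (\<Sum>f\<in>F. \<Sum>y\<in>X. A X j (f s) y))"
      unfolding sum_distrib_left[of "m ^ l" _ F, symmetric] by (rule mult.left_commute)
    also have "m * (\<Sum>f\<in>F. \<Sum>y\<in>X. A X j (f s) y) = m ^ l * (\<Sum>x\<in>X. \<Sum>y\<in>X. A X j x y)"
      using 1[OF that(1), of "\<lambda>x. \<Sum>y\<in>X. A X j x y"] .
    finally show ?thesis by (simp only: power2_eq_square mult.assoc)
  qed
  have total: "m\<^sup>2 * (\<Sum>p\<in>F \<times> F. D j p) = (real l)\<^sup>2 * (m ^ l)\<^sup>2 * (\<Sum>x\<in>X. \<Sum>y\<in>X. A X j x y)" for j
  proof -
    have "(\<Sum>p\<in>F \<times> F. D j p) = (\<Sum>f\<in>F. \<Sum>g\<in>F. \<Sum>s<l. \<Sum>t<l. A X j (f s) (g t))"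
      by (simp add: sum.cartesian_product' D)
    also have "\<dots> = (\<Sum>s<l. \<Sum>t<l. \<Sum>f\<in>F. \<Sum>g\<in>F. A X j (f s) (g t))"
      by (rule sum_swap_pairs)
    finally have "m\<^sup>2 * (\<Sum>p\<in>F \<times> F. D j p) = (\<Sum>s<l. \<Sum>t<l. m\<^sup>2 * (\<Sum>f\<in>F. \<Sum>g\<in>F. A X j (f s) (g t)))"
      by (simp add: sum_distrib_left)
    also have "\<dots> = (\<Sum>s<l. \<Sum>t<l. (m ^ l)\<^sup>2 * (\<Sum>x\<in>X. \<Sum>y\<in>X. A X j x y))"
      by (intro sum.cong refl mean) auto
    finally show ?thesis by (simp add: power2_eq_square)
  qed
  \<comment> \<open>Equal position pairs square an entry of \<open>A\<close>, at cost
    \<open>a\<close>. Otherwise one position is new: its entry is independent of the first factor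
    and averages a row or a column of \<open>A\<close>, at cost \<open>r / m\<close>.\<close>
  have pair: "(\<Sum>f\<in>F. \<Sum>g\<in>F. A X j (f s) (g t) * A X j (f s') (g t'))
      \<le> (if s = s' \<and> t = t' then a else r / m) * (\<Sum>f\<in>F. \<Sum>g\<in>F. A X j (f s) (g t))"
    if "j < k" "s < l" "t < l" "s' < l" "t' < l" for j s t s' t'
  proof -
    consider "s = s'" "t = t'" | "t \<noteq> t'" | "s \<noteq> s'" by blast
    then show ?thesis
    proof cases
      case 1
      have "A X j (f s) (g t) * A X j (f s) (g t) \<le> a * A X j (f s) (g t)" if "f \<in> F" "g \<in> F" for f g
        using that \<open>j < k\<close> \<open>s < l\<close> \<open>t < l\<close> by (intro mult_right_mono entry A0) (auto simp: F_def)
      with 1 show ?thesis by (simp add: sum_distrib_left sum_mono)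
    next
      case 2
      have "(\<Sum>g\<in>F. A X j (f s) (g t) * A X j (f s') (g t')) \<le> r / m * (\<Sum>g\<in>F. A X j (f s) (g t))"
        if "f \<in> F" for f
        unfolding F_def m_def using that \<open>s' < l\<close>
        by (intro sum_PiE_pair_le X A0 row 2 \<open>j < k\<close> \<open>t < l\<close> \<open>t' < l\<close>) (auto simp: F_def)
      then have "(\<Sum>f\<in>F. \<Sum>g\<in>F. A X j (f s) (g t) * A X j (f s') (g t'))
          \<le> (\<Sum>f\<in>F. r / m * (\<Sum>g\<in>F. A X j (f s) (g t)))"
        by (rule sum_mono)
      with 2 show ?thesis unfolding sum_distrib_left[of "r / m" _ F, symmetric] by simp
    next
      case 3
      have "(\<Sum>f\<in>F. A X j (f s) (g t) * A X j (f s') (g t')) \<le> r / m * (\<Sum>f\<in>F. A X j (f s) (g t))"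
        if "g \<in> F" for g
        unfolding F_def m_def using that \<open>t' < l\<close>
        by (intro sum_PiE_pair_le[where h = "\<lambda>x. A X j x (g t)" and h' = "\<lambda>x. A X j x (g t')"]
            X A0 col 3 \<open>j < k\<close> \<open>s < l\<close> \<open>s' < l\<close>) (auto simp: F_def)
      then have "(\<Sum>g\<in>F. \<Sum>f\<in>F. A X j (f s) (g t) * A X j (f s') (g t'))
          \<le> (\<Sum>g\<in>F. r / m * (\<Sum>f\<in>F. A X j (f s) (g t)))"
        by (rule sum_mono)
      then have "(\<Sum>f\<in>F. \<Sum>g\<in>F. A X j (f s) (g t) * A X j (f s') (g t'))
          \<le> r / m * (\<Sum>f\<in>F. \<Sum>g\<in>F. A X j (f s) (g t))"
        unfolding sum_distrib_left[of "r / m" _ F, symmetric]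
        by (subst (1 2) sum.swap)
      with 3 show ?thesis by simp
    qed
  qed
  have moment: "(\<Sum>p\<in>F \<times> F. (D j p)\<^sup>2) \<le> \<Lambda> * (\<Sum>p\<in>F \<times> F. D j p)" if "j < k" for j
  proof -
    let ?S = "\<lambda>s t. \<Sum>f\<in>F. \<Sum>g\<in>F. A X j (f s) (g t)"
    \<comment> \<open>For fixed \<open>s\<close> and \<open>t\<close>, just one of the
      \<open>l^2\<close> pairs contributes \<open>a\<close>; charging \<open>r / m\<close> to all
      pairs in addition gives \<open>\<Lambda>\<close>.\<close>
    have weight: "(\<Sum>s'<l. \<Sum>t'<l. if s = s' \<and> t = t' then a else r / m) \<le> \<Lambda>" if "s < l" "t < l" for s t
    proof -
      have "(\<Sum>s'<l. \<Sum>t'<l. if s = s' \<and> t = t' then a else r / m)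
          \<le> (\<Sum>s'<l. \<Sum>t'<l. (if s = s' then if t = t' then a else 0 else 0) + r / m)"
        using pos m by (intro sum_mono) auto
      also have "\<dots> = \<Lambda>"
        using that by (simp add: sum.distrib \<Lambda>_def power2_eq_square if_distrib[of "\<lambda>f. sum f _"] cong: if_cong)
          (simp add: sum.If_cases)
      finally show ?thesis .
    qed
    have "(\<Sum>p\<in>F \<times> F. (D j p)\<^sup>2) = (\<Sum>f\<in>F. \<Sum>g\<in>F. (\<Sum>s<l. \<Sum>t<l. A X j (f s) (g t))\<^sup>2)"
      by (simp add: sum.cartesian_product' D)
    also have "\<dots> = (\<Sum>f\<in>F. \<Sum>g\<in>F. \<Sum>s<l. \<Sum>t<l. \<Sum>s'<l. \<Sum>t'<l. A X j (f s) (g t) * A X j (f s') (g t'))"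
      by (simp only: power2_eq_square sum_distrib_right) (simp only: sum_distrib_left)
    also have "\<dots> = (\<Sum>s<l. \<Sum>t<l. \<Sum>s'<l. \<Sum>t'<l. \<Sum>f\<in>F. \<Sum>g\<in>F. A X j (f s) (g t) * A X j (f s') (g t'))"
      by (subst sum_swap_pairs) (intro sum.cong refl sum_swap_pairs)
    also have "\<dots> \<le> (\<Sum>s<l. \<Sum>t<l. \<Sum>s'<l. \<Sum>t'<l. (if s = s' \<and> t = t' then a else r / m) * ?S s t)"
      by (intro sum_mono pair that) auto
    also have "\<dots> = (\<Sum>s<l. \<Sum>t<l. (\<Sum>s'<l. \<Sum>t'<l. if s = s' \<and> t = t' then a else r / m) * ?S s t)"
      by (simp add: sum_distrib_right)
    also have "\<dots> \<le> (\<Sum>s<l. \<Sum>t<l. \<Lambda> * ?S s t)"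
      by (intro sum_mono mult_right_mono weight sum_nonneg A0) auto
    also have "\<dots> = \<Lambda> * (\<Sum>p\<in>F \<times> F. D j p)"
      unfolding sum_distrib_left[symmetric]
      by (subst sum_swap_pairs) (simp add: sum.cartesian_product' D)
    finally show ?thesis .
  qed
  \<comment> \<open>The label of a vertex is the sum of \<open>c\<close> over all its
    \<open>2 * l\<close> entries. Along an edge the unchanged entries cancel in characteristic two,
    which leaves \<open>c x + c x' + c y + c y'\<close>.\<close>
  define \<phi> where "\<phi> p i \<longleftrightarrow> (\<Sum>s<l. c (fst p s) i) + (\<Sum>t<l. c (snd p t) i) = 1"
    for p :: "(nat \<Rightarrow> 'a) \<times> (nat \<Rightarrow> 'a)" and i
  have diff: "(\<Sum>s<l. c (f s) i) + (\<Sum>s<l. c (f' s) i) = c (f s) i + c (f' s) i"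
    if "agree_off l s f f' \<noteq> 0" "s < l" for f f' s i
  proof -
    have "(\<Sum>s<l. c (f s) i) + (\<Sum>s<l. c (f' s) i) = (\<Sum>r<l. c (f r) i + c (f' r) i)"
      by (rule sum.distrib[symmetric])
    also have "\<dots> = (\<Sum>r\<in>{s}. c (f r) i + c (f' r) i)"
      using that by (intro sum.mono_neutral_right) (auto simp: agree_off_def split: if_splits)
    finally show ?thesis by simp
  qed
  have bitsum: "\<phi> p i \<noteq> \<phi> q i \<longleftrightarrow>
      ((\<Sum>s<l. c (fst p s) i) + (\<Sum>s<l. c (fst q s) i)) + ((\<Sum>t<l. c (snd p t) i) + (\<Sum>t<l. c (snd q t) i)) = 1"
    for p q i
  proof -
    have "(x + y = 1) \<noteq> (z + w = 1) \<longleftrightarrow> (x + z) + (y + w) = 1" for x y z w :: bit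
      by (cases x; cases y; cases z; cases w) auto
    then show ?thesis unfolding \<phi>_def .
  qed
  have "(\<Sum>j<k. \<Sum>p\<in>F \<times> F. D j p) \<le> 8 * \<Lambda> * (real (card (F \<times> F)) * log 2 (real (card (F \<times> F))))"
    unfolding D_def
  proof (rule degree_sum_le[where \<phi> = \<phi>])
    show "finite (F \<times> F)" using finF by simp
    show "0 \<le> B j u v" for j u v unfolding B_def by (intro sum_nonneg mult_nonneg_nonneg nn) auto
    show "B j u v = B j v u" for j u v
      unfolding B_def by (intro sum.cong refl arg_cong2[where f = "(*)"] agree_off_sym sym)
    show "(\<Sum>u\<in>F \<times> F. (\<Sum>v\<in>F \<times> F. B j u v)\<^sup>2) \<le> \<Lambda> * (\<Sum>u\<in>F \<times> F. \<Sum>v\<in>F \<times> F. B j u v)" if "j < k" for j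
      using moment[OF that] unfolding D_def .
    show "\<phi> p j \<noteq> \<phi> q j \<and> (\<forall>i. j < i \<longrightarrow> i < k \<longrightarrow> \<phi> p i = \<phi> q i)"
      if j: "j < k" and B: "B j p q \<noteq> 0" for j p q
    proof -
      obtain s t where st: "s < l" "t < l" and ne: "agree_off l s (fst p) (fst q) \<noteq> 0"
          "agree_off l t (snd p) (snd q) \<noteq> 0" "\<beta> j (fst p s) (fst q s) (snd p t) (snd q t) \<noteq> 0"
        using B unfolding B_def by (auto elim!: sum.not_neutral_contains_not_neutral)
      have "\<phi> p i \<noteq> \<phi> q i \<longleftrightarrow> c (fst p s) i + c (fst q s) i + c (snd p t) i + c (snd q t) i = 1" for i
        unfolding bitsum diff[OF ne(1) st(1)] diff[OF ne(2) st(2)] by (simp only: add.assoc)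
      then show ?thesis using sep[OF j ne(3)] by (metis zero_neq_one)
    qed
  qed (rule \<Lambda>)
  \<comment> \<open>The number of vertices is \<open>m ^ (2 * l)\<close>; the exponent leaves the
    logarithm and its \<open>2\<close> doubles the \<open>8\<close>.\<close>
  then have main: "(\<Sum>j<k. \<Sum>p\<in>F \<times> F. D j p) \<le> 16 * \<Lambda> * (m ^ l)\<^sup>2 * (real l * log 2 m)"
    using m cardF by (simp add: card_cartesian_product log_mult log_nat_power power2_eq_square)
  have "(real l)\<^sup>2 * (m ^ l)\<^sup>2 * (\<Sum>j<k. \<Sum>x\<in>X. \<Sum>y\<in>X. A X j x y) = m\<^sup>2 * (\<Sum>j<k. \<Sum>p\<in>F \<times> F. D j p)"
    unfolding sum_distrib_left[of _ _ "{..<k}"] total ..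
  also have "\<dots> \<le> m\<^sup>2 * (16 * \<Lambda> * (m ^ l)\<^sup>2 * (real l * log 2 m))"
    by (intro mult_left_mono main) auto
  finally have "(real l * (m ^ l)\<^sup>2) * (real l * (\<Sum>j<k. \<Sum>x\<in>X. \<Sum>y\<in>X. A X j x y))
      \<le> (real l * (m ^ l)\<^sup>2) * (16 * \<Lambda> * m\<^sup>2 * log 2 m)"
    by (simp add: power2_eq_square mult_ac)
  moreover have "0 < real l * (m ^ l)\<^sup>2" using l m by simp
  ultimately have "real l * (\<Sum>j<k. \<Sum>x\<in>X. \<Sum>y\<in>X. A X j x y) \<le> 16 * \<Lambda> * m\<^sup>2 * log 2 m"
    using mult_le_cancel_left_pos by blast
  then show ?thesis by (simp add: \<Lambda>_def m_def)
qed

section \<open>Weighted systems of triples\<close>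

lemma square_sum_eq:
  fixes t :: "nat \<Rightarrow> real"
  shows "(\<Sum>j<k. t j)\<^sup>2 = (\<Sum>j<k. (t j)\<^sup>2) + 2 * (\<Sum>j<k. t j * (\<Sum>i<j. t i))"
  by (induction k) (simp_all add: power2_sum algebra_simps)

text \<open>\<open>T\<close> weighs ordered triples of each colour and is invariant under all
  permutations. In a matching the one triple through \<open>x\<close> is thus seen in two orders,
  whence the bound \<open>2\<close>, while two entries fix the third, whence the bound
  \<open>1\<close>. Stating this for weights lets the same lemmas serve again after some triples
  have been deleted.\<close>

locale triple_system =
  fixes T :: "nat \<Rightarrow> 'a \<Rightarrow> 'a \<Rightarrow> 'a \<Rightarrow> real" and X :: "'a set" and k :: nat and c :: "'a \<Rightarrow> nat \<Rightarrow> bit"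
  assumes finite_X: "finite X" and X_nonempty: "X \<noteq> {}"
    and nonneg: "0 \<le> T j x y z"
    and swap12: "T j x y z = T j y x z"
    and swap23: "T j x y z = T j x z y"
    and degree_le: "j < k \<Longrightarrow> x \<in> X \<Longrightarrow> (\<Sum>y\<in>X. \<Sum>z\<in>X. T j x y z) \<le> 2"
    and third_le: "j < k \<Longrightarrow> x \<in> X \<Longrightarrow> y \<in> X \<Longrightarrow> (\<Sum>z\<in>X. T j x y z) \<le> 1"
    and decode: "j < k \<Longrightarrow> T j x y z \<noteq> 0 \<Longrightarrow> i < k \<Longrightarrow> c x i + c y i + c z i = of_bool (i = j)"
begin

definition deg :: "nat \<Rightarrow> 'a \<Rightarrow> real" where "deg j x = (\<Sum>y\<in>X. \<Sum>z\<in>X. T j x y z)"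
definition codeg :: "'a \<Rightarrow> 'a \<Rightarrow> real" where "codeg x y = (\<Sum>j<k. \<Sum>z\<in>X. T j x y z)"
definition mass :: real where "mass = (\<Sum>x\<in>X. \<Sum>j<k. deg j x)"

lemma deg_nonneg: "0 \<le> deg j x"
  unfolding deg_def by (intro sum_nonneg nonneg)

lemma deg_le: "j < k \<Longrightarrow> x \<in> X \<Longrightarrow> deg j x \<le> 2"
  unfolding deg_def by (rule degree_le)

lemma codeg_sym: "codeg x y = codeg y x"
  unfolding codeg_def by (simp add: swap12)

lemma swap13: "T j x y z = T j z y x"
  by (metis swap12 swap23)

lemma rotate: "T j x y z = T j y z x"
  by (metis swap12 swap23)

lemma mass_le: "mass \<le> 2 * real k * real (card X)"
proof -
  have "mass \<le> (\<Sum>x\<in>X. \<Sum>j<k. 2)"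
    unfolding mass_def by (intro sum_mono deg_le) auto
  then show ?thesis by (simp add: mult_ac)
qed

lemma mass_eq_sum_codeg: "mass = (\<Sum>x\<in>X. \<Sum>y\<in>X. codeg x y)"
  unfolding mass_def deg_def codeg_def by (intro sum.cong refl sum.swap)

section \<open>Pairs of triples with a common element\<close>

text \<open>Cauchy-Schwarz for the degrees summed over all colours. In the square of such a degree
  the diagonal terms are at most \<open>2 * deg j u\<close>, which is the origin of the subtracted
  \<open>2\<close>; half of the rest are the pairs with \<open>i < j\<close>.\<close>

lemma mass_pairs_lower:
  "mass * (mass / real (card X) - 2) / 2 \<le> (\<Sum>j<k. \<Sum>u\<in>X. deg j u * (\<Sum>i<j. deg i u))"
proof -
  define \<tau> where "\<tau> u = (\<Sum>j<k. deg j u)" for u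
  have m: "0 < real (card X)" using finite_X X_nonempty by (simp add: card_gt_0_iff)
  have "(\<tau> u)\<^sup>2 / 2 - \<tau> u \<le> (\<Sum>j<k. deg j u * (\<Sum>i<j. deg i u))" if "u \<in> X" for u
  proof -
    have "(deg j u)\<^sup>2 \<le> 2 * deg j u" if "j < k" for j
      using deg_le[OF that \<open>u \<in> X\<close>] deg_nonneg[of j u] by (simp add: power2_eq_square mult_right_mono)
    then have "(\<Sum>j<k. (deg j u)\<^sup>2) \<le> 2 * \<tau> u"
      unfolding \<tau>_def sum_distrib_left by (intro sum_mono) auto
    then show ?thesis using square_sum_eq[of "\<lambda>j. deg j u" k] unfolding \<tau>_def by linarith
  qed
  then have "(\<Sum>u\<in>X. (\<tau> u)\<^sup>2 / 2 - \<tau> u) \<le> (\<Sum>u\<in>X. \<Sum>j<k. deg j u * (\<Sum>i<j. deg i u))"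
    by (rule sum_mono)
  then have 1: "(\<Sum>u\<in>X. (\<tau> u)\<^sup>2) / 2 - mass \<le> (\<Sum>u\<in>X. \<Sum>j<k. deg j u * (\<Sum>i<j. deg i u))"
    by (simp add: sum_subtractf sum_divide_distrib mass_def \<tau>_def)
  have "mass\<^sup>2 \<le> (\<Sum>u\<in>X. (\<tau> u)\<^sup>2) * real (card X)"
    using sum_squared_le_sum_of_squares[of \<tau> X] by (simp add: mass_def \<tau>_def)
  then have "mass * (mass / real (card X)) \<le> (\<Sum>u\<in>X. (\<tau> u)\<^sup>2)"
    using m by (simp add: field_simps power2_eq_square)
  with 1 show ?thesis by (subst sum.swap) (simp add: algebra_simps)
qed

text \<open>Gluing a triple of colour \<open>j\<close> to one of lower colour at a common
  \<open>u\<close> gives the weights for \<open>kikuchi_bound\<close>. Its matrix \<open>A\<close>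
  is the product of \<open>g\<close> and \<open>q\<close>. Entries of \<open>q\<close> are at most
  \<open>d\<close> and row sums of \<open>g\<close> at most \<open>2\<close>, so
  \<open>a = 2 * d\<close>; rows and columns sum to at most \<open>2\<close> in \<open>g\<close> and
  \<open>2 * k\<close> in \<open>q\<close>, so \<open>r = 4 * k\<close>.\<close>

lemma light_bound:
  assumes l: "0 < l" and d: "0 < d" and cod: "\<And>x y. x \<in> X \<Longrightarrow> y \<in> X \<Longrightarrow> codeg x y \<le> d"
  shows "real l * (mass * (mass / real (card X) - 2) / 2)
    \<le> 16 * (2 * d + (real l)\<^sup>2 * (4 * real k) / real (card X)) * (real (card X))\<^sup>2 * log 2 (real (card X))"
proof -
  define q where "q j u y = (\<Sum>i<j. \<Sum>z\<in>X. T i u y z)" for j u y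
  define g where "g j x u = (\<Sum>x'\<in>X. T j x u x')" for j x u
  \<comment> \<open>All lower colours are merged: the edge gets colour \<open>j\<close>, the top
    coordinate in which its ends differ, and the isoperimetric inequality does not look below
    it.\<close>
  define \<beta> where "\<beta> j x x' y y' = (\<Sum>u\<in>X. T j x u x' * (\<Sum>i<j. T i u y y'))" for j x x' y y'
  have q0: "0 \<le> q j u y" and g0: "0 \<le> g j x u" for j x u y
    unfolding q_def g_def by (intro sum_nonneg nonneg)+
  have A: "(\<Sum>x'\<in>X. \<Sum>y'\<in>X. \<beta> j x x' y y') = (\<Sum>u\<in>X. g j x u * q j u y)" for j x y
  proof -
    have "(\<Sum>x'\<in>X. \<Sum>y'\<in>X. \<beta> j x x' y y') = (\<Sum>x'\<in>X. \<Sum>u\<in>X. \<Sum>y'\<in>X. T j x u x' * (\<Sum>i<j. T i u y y'))"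
      unfolding \<beta>_def by (intro sum.cong refl sum.swap)
    also have "\<dots> = (\<Sum>u\<in>X. \<Sum>x'\<in>X. T j x u x' * (\<Sum>y'\<in>X. \<Sum>i<j. T i u y y'))"
      by (subst sum.swap) (simp add: sum_distrib_left)
    also have "\<dots> = (\<Sum>u\<in>X. g j x u * q j u y)"
      unfolding g_def q_def by (subst (2) sum.swap) (simp add: sum_distrib_right)
    finally show ?thesis .
  qed
  have q_le: "q j u y \<le> d" if "j < k" "u \<in> X" "y \<in> X" for j u y
  proof -
    have "q j u y \<le> codeg u y"
      unfolding q_def codeg_def using that by (intro sum_mono2 sum_nonneg nonneg) auto
    also have "\<dots> \<le> d" by (rule cod) fact+
    finally show ?thesis .
  qed
  have g_row: "(\<Sum>u\<in>X. g j x u) = deg j x" for j x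
    unfolding g_def deg_def ..
  have g_col: "(\<Sum>x\<in>X. g j x u) = deg j u" for j u
    unfolding g_def deg_def by (simp add: swap12)
  have q_row: "(\<Sum>y\<in>X. q j u y) = (\<Sum>i<j. deg i u)" for j u
    unfolding q_def deg_def by (rule sum.swap)
  have q_sym: "q j u y = q j y u" for j u y
    unfolding q_def by (simp add: swap12)
  have degs: "(\<Sum>i<j. deg i u) \<le> 2 * real k" if "j < k" "u \<in> X" for j u
  proof -
    have "(\<Sum>i<j. deg i u) \<le> (\<Sum>i<j. 2)" using that by (intro sum_mono deg_le) auto
    then show ?thesis using that by simp
  qed
  have total: "(\<Sum>x\<in>X. \<Sum>y\<in>X. \<Sum>u\<in>X. g j x u * q j u y) = (\<Sum>u\<in>X. deg j u * (\<Sum>i<j. deg i u))" for j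
  proof -
    have "(\<Sum>x\<in>X. \<Sum>y\<in>X. \<Sum>u\<in>X. g j x u * q j u y) = (\<Sum>x\<in>X. \<Sum>u\<in>X. g j x u * (\<Sum>y\<in>X. q j u y))"
      by (simp add: sum_distrib_left) (intro sum.cong refl sum.swap)
    also have "\<dots> = (\<Sum>u\<in>X. (\<Sum>x\<in>X. g j x u) * (\<Sum>y\<in>X. q j u y))"
      by (subst sum.swap) (simp add: sum_distrib_right)
    finally show ?thesis unfolding g_col q_row .
  qed
  have "real l * (\<Sum>j<k. \<Sum>x\<in>X. \<Sum>y\<in>X. \<Sum>x'\<in>X. \<Sum>y'\<in>X. \<beta> j x x' y y')
    \<le> 16 * (2 * d + (real l)\<^sup>2 * (4 * real k) / real (card X)) * (real (card X))\<^sup>2 * log 2 (real (card X))"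
  proof (rule kikuchi_bound[OF finite_X X_nonempty l, where c = c])
    show "0 < 2 * d" "0 \<le> 4 * real k" using d by auto
    show "0 \<le> \<beta> j x x' y y'" for j x x' y y'
      unfolding \<beta>_def by (intro sum_nonneg mult_nonneg_nonneg nonneg)
    show "\<beta> j x x' y y' = \<beta> j x' x y' y" for j x x' y y'
      unfolding \<beta>_def
      by (intro sum.cong refl arg_cong2[where f = "(*)"]) (rule swap13 swap23)+
    show "(\<Sum>x'\<in>X. \<Sum>y'\<in>X. \<beta> j x x' y y') \<le> 2 * d" if "j < k" "x \<in> X" "y \<in> X" for j x y
    proof -
      have "(\<Sum>u\<in>X. g j x u * q j u y) \<le> (\<Sum>u\<in>X. g j x u * d)"
        using that by (intro sum_mono mult_left_mono q_le g0)
      also have "\<dots> = deg j x * d" by (simp add: g_row flip: sum_distrib_right)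
      also have "\<dots> \<le> 2 * d" using that d by (intro mult_right_mono deg_le) auto
      finally show ?thesis unfolding A .
    qed
    show "(\<Sum>y\<in>X. \<Sum>x'\<in>X. \<Sum>y'\<in>X. \<beta> j x x' y y') \<le> 4 * real k" if "j < k" "x \<in> X" for j x
    proof -
      have "(\<Sum>y\<in>X. \<Sum>u\<in>X. g j x u * q j u y) = (\<Sum>u\<in>X. g j x u * (\<Sum>i<j. deg i u))"
        by (subst sum.swap) (simp add: q_row flip: sum_distrib_left)
      also have "\<dots> \<le> (\<Sum>u\<in>X. g j x u * (2 * real k))"
        using that by (intro sum_mono mult_left_mono degs g0)
      also have "\<dots> = deg j x * (2 * real k)" by (simp add: g_row flip: sum_distrib_right)
      also have "\<dots> \<le> 2 * (2 * real k)" using that by (intro mult_right_mono deg_le) auto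
      finally show ?thesis unfolding A by simp
    qed
    show "(\<Sum>x\<in>X. \<Sum>x'\<in>X. \<Sum>y'\<in>X. \<beta> j x x' y y') \<le> 4 * real k" if "j < k" "y \<in> X" for j y
    proof -
      have "(\<Sum>x\<in>X. \<Sum>u\<in>X. g j x u * q j u y) = (\<Sum>u\<in>X. deg j u * q j u y)"
        by (subst sum.swap) (simp add: g_col flip: sum_distrib_right)
      also have "\<dots> \<le> (\<Sum>u\<in>X. 2 * q j u y)"
        using that by (intro sum_mono mult_right_mono deg_le q0)
      also have "\<dots> = 2 * (\<Sum>i<j. deg i y)"
        by (simp add: q_sym[of j _ y] q_row flip: sum_distrib_left)
      also have "\<dots> \<le> 2 * (2 * real k)" using that by (intro mult_left_mono degs) auto
      finally show ?thesis unfolding A by simp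
    qed
    show "c x j + c x' j + c y j + c y' j = 1 \<and> (\<forall>i. j < i \<longrightarrow> i < k \<longrightarrow> c x i + c x' i + c y i + c y' i = 0)"
      if j: "j < k" and \<beta>: "\<beta> j x x' y y' \<noteq> 0" for j x x' y y'
    proof -
      obtain u where u: "T j x u x' * (\<Sum>i<j. T i u y y') \<noteq> 0"
        using \<beta> unfolding \<beta>_def by (auto elim!: sum.not_neutral_contains_not_neutral)
      then obtain h where h: "h < j" "T h u y y' \<noteq> 0"
        by (auto elim!: sum.not_neutral_contains_not_neutral)
      \<comment> \<open>The shared \<open>u\<close> occurs in both decoding identities and cancels
        in characteristic two.\<close>
      have cancel: "x + x' + y + y' = (x + u + x') + (u + y + y')" for x x' y y' u :: bit
        by (cases x; cases x'; cases y; cases y'; cases u) auto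
      have "c x i + c x' i + c y i + c y' i = of_bool (i = j) + of_bool (i = h)" if "i < k" for i
      proof -
        have "c x i + c u i + c x' i = of_bool (i = j)" using decode[OF j _ that] u by auto
        moreover have "c u i + c y i + c y' i = of_bool (i = h)" using decode[OF _ h(2) that] h j by auto
        ultimately show ?thesis by (simp only: cancel[of "c x i" "c x' i" _ _ "c u i"])
      qed
      then show ?thesis using h j by auto
    qed
  qed
  then have "real l * (\<Sum>j<k. \<Sum>u\<in>X. deg j u * (\<Sum>i<j. deg i u))
    \<le> 16 * (2 * d + (real l)\<^sup>2 * (4 * real k) / real (card X)) * (real (card X))\<^sup>2 * log 2 (real (card X))"
    unfolding A total .
  moreover have "real l * (mass * (mass / real (card X) - 2) / 2) \<le> real l * (\<Sum>j<k. \<Sum>u\<in>X. deg j u * (\<Sum>i<j. deg i u))"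
    by (intro mult_left_mono mass_pairs_lower) auto
  ultimately show ?thesis by linarith
qed

section \<open>Pairs of large codegree\<close>

definition heavy :: "real \<Rightarrow> ('a \<times> 'a) set" where
  "heavy d = {(x, y). x \<in> X \<and> y \<in> X \<and> d < codeg x y}"

lemma heavy_subset: "heavy d \<subseteq> X \<times> X"
  by (auto simp: heavy_def)

lemma finite_heavy: "finite (heavy d)"
  by (rule finite_subset[OF heavy_subset finite_cartesian_product[OF finite_X finite_X]])

lemma codeg_nonneg: "0 \<le> codeg x y"
  unfolding codeg_def by (intro sum_nonneg nonneg)

text \<open>Markov's inequality: the codegrees of all ordered pairs add up to
  \<open>mass\<close>.\<close>

lemma card_heavy_le:
  assumes "0 < d"
  shows "real (card (heavy d)) \<le> 2 * real k * real (card X) / d"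
proof -
  have "real (card (heavy d)) * d = (\<Sum>p\<in>heavy d. d)" by simp
  also have "\<dots> \<le> (\<Sum>(x, y)\<in>heavy d. codeg x y)"
    by (intro sum_mono) (auto simp: heavy_def)
  also have "\<dots> \<le> (\<Sum>(x, y)\<in>X \<times> X. codeg x y)"
    using heavy_subset finite_X by (intro sum_mono2) (auto simp: codeg_nonneg)
  also have "\<dots> \<le> 2 * real k * real (card X)"
    using mass_le mass_eq_sum_codeg by (simp add: sum.cartesian_product)
  finally show ?thesis using assms by (simp add: field_simps)
qed

text \<open>Merging each heavy pair into a new coordinate turns the triples through it into a 2-query code
  on only slightly more coordinates.\<close>

lemma heavy_mass_le:
  assumes d: "0 < d" and X2: "2 \<le> card X"
  shows "(\<Sum>j<k. \<Sum>(x, y)\<in>heavy d. \<Sum>z\<in>X. T j x y z)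
    \<le> 3 * (real (card X) + 2 * real k * real (card X) / d) * log 2 (real (card X))"
proof -
  define V where "V = heavy d <+> X"
  define W where "W j u v = (case (u, v) of (Inl (x, y), Inr z) \<Rightarrow> T j x y z / 2
     | (Inr z, Inl (x, y)) \<Rightarrow> T j x y z / 2 | _ \<Rightarrow> 0)" for j and u v :: "('a \<times> 'a) + 'a"
  define \<phi> where "\<phi> u i = (case u of Inl (x, y) \<Rightarrow> c x i + c y i = 1 | Inr z \<Rightarrow> c z i = 1)"
    for u :: "('a \<times> 'a) + 'a" and i
  have W_simps [simp]: "W j (Inl (x, y)) (Inr z) = T j x y z / 2" "W j (Inr z) (Inl (x, y)) = T j x y z / 2"
    "W j (Inl p) (Inl p') = 0" "W j (Inr z) (Inr z') = 0" for j x y z z' p p'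
    by (auto simp: W_def split: prod.splits)
  have finV: "finite V" using finite_heavy finite_X by (simp add: V_def)
  have sumV: "(\<Sum>v\<in>V. h v) = (\<Sum>p\<in>heavy d. h (Inl p)) + (\<Sum>z\<in>X. h (Inr z))" for h :: "_ \<Rightarrow> real"
    unfolding V_def using finite_heavy finite_X by (simp add: sum.Plus)
  have Wsym: "W j u v = W j v u" for j u v
    by (auto simp: W_def split: sum.splits prod.splits)
  have row: "(\<Sum>v\<in>V. W j u v) \<le> 1" if j: "j < k" and u: "u \<in> V" for j u
  proof (cases u)
    case (Inl p)
    then obtain x y where p: "p = (x, y)" "x \<in> X" "y \<in> X"
      using u heavy_subset by (cases p) (auto simp: V_def)
    show ?thesis using third_le[OF j p(2,3)] by (simp add: sumV Inl p flip: sum_divide_distrib)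
  next
    case (Inr z)
    then have z: "z \<in> X" using u by (auto simp: V_def)
    have "(\<Sum>v\<in>V. W j u v) = (\<Sum>(x, y)\<in>heavy d. T j x y z / 2)"
      by (simp add: sumV Inr) (intro sum.cong refl, auto)
    also have "\<dots> \<le> (\<Sum>(x, y)\<in>X \<times> X. T j x y z / 2)"
      using heavy_subset finite_X by (intro sum_mono2) (auto simp: nonneg)
    also have "\<dots> = (\<Sum>x\<in>X. \<Sum>y\<in>X. T j z y x) / 2"
      by (simp add: sum.cartesian_product[symmetric] swap13[of j _ _ z] flip: sum_divide_distrib)
    also have "\<dots> = deg j z / 2" unfolding deg_def by (subst sum.swap) (rule refl)
    also have "\<dots> \<le> 1" using deg_le[OF j z] by simp
    finally show ?thesis .
  qed
  have "(\<Sum>j<k. \<Sum>u\<in>V. \<Sum>v\<in>V. W j u v) \<le> real (card V) * log 2 (real (card V))"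
  proof (rule weighted_edge_isoperimetry[OF finV, where \<phi> = \<phi>])
    show "0 \<le> W j u v" for j u v
      by (auto simp: W_def nonneg split: sum.splits prod.splits)
    show "(\<Sum>u\<in>V. W j u v) \<le> 1" if "j < k" "v \<in> V" for j v
      using row[OF that] by (simp add: Wsym[of j _ v])
    show "\<phi> u j \<noteq> \<phi> v j \<and> (\<forall>i. j < i \<longrightarrow> i < k \<longrightarrow> \<phi> u i = \<phi> v i)"
      if j: "j < k" and W: "W j u v \<noteq> 0" for j u v
    proof -
      have bits: "(x + y = 1) = (z = 1) \<longleftrightarrow> x + y + z = 0" for x y z :: bit
        by (cases x; cases y; cases z) auto
      obtain x y z where "T j x y z \<noteq> 0" "(u = Inl (x, y) \<and> v = Inr z) \<or> (v = Inl (x, y) \<and> u = Inr z)"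
        using W by (auto simp: W_def split: sum.splits prod.splits)
      moreover have "((c x i + c y i = 1) = (c z i = 1)) \<longleftrightarrow> i \<noteq> j" if "i < k" for i
        unfolding bits using decode[OF j \<open>T j x y z \<noteq> 0\<close> that] by simp
      ultimately show ?thesis using j unfolding \<phi>_def by fastforce
    qed
  qed (rule row)
  also have "(\<Sum>j<k. \<Sum>u\<in>V. \<Sum>v\<in>V. W j u v) = (\<Sum>j<k. \<Sum>(x, y)\<in>heavy d. \<Sum>z\<in>X. T j x y z)"
  proof (intro sum.cong refl)
    fix j
    have 1: "(\<Sum>p\<in>heavy d. \<Sum>z\<in>X. W j (Inl p) (Inr z)) = (\<Sum>(x, y)\<in>heavy d. \<Sum>z\<in>X. T j x y z) / 2"
      by (simp add: sum_divide_distrib case_prod_unfold) (intro sum.cong refl, auto simp: W_def split: prod.splits)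
    have "(\<Sum>u\<in>V. \<Sum>v\<in>V. W j u v) = (\<Sum>p\<in>heavy d. \<Sum>z\<in>X. W j (Inl p) (Inr z)) + (\<Sum>z\<in>X. \<Sum>p\<in>heavy d. W j (Inr z) (Inl p))"
      by (simp add: sumV)
    also have "\<dots> = 2 * (\<Sum>p\<in>heavy d. \<Sum>z\<in>X. W j (Inl p) (Inr z))"
      by (subst (2) sum.swap) (simp add: Wsym[of j "Inr _"])
    finally show "(\<Sum>u\<in>V. \<Sum>v\<in>V. W j u v) = (\<Sum>(x, y)\<in>heavy d. \<Sum>z\<in>X. T j x y z)"
      using 1 by simp
  qed
  finally have main: "(\<Sum>j<k. \<Sum>(x, y)\<in>heavy d. \<Sum>z\<in>X. T j x y z) \<le> real (card V) * log 2 (real (card V))" .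
  have cardV: "card V = card (heavy d) + card X"
    unfolding V_def using finite_heavy finite_X by (simp add: card_Plus)
  \<comment> \<open>With \<open>m = card X\<close>, the crude count
    \<open>card V \<le> m^2 + m \<le> m^3\<close> costs only a factor \<open>3\<close> in the
    logarithm.\<close>
  have "card (heavy d) \<le> card X * card X"
    using card_mono[OF _ heavy_subset, of d] finite_X by (simp add: card_cartesian_product)
  moreover have "card X * card X + card X \<le> card X ^ 3"
    using mult_le_mono1[OF X2, of "card X * card X"] le_square[of "card X"]
    unfolding power3_eq_cube mult.assoc by linarith
  ultimately have "card V \<le> card X ^ 3" using cardV by linarith
  then have "real (card V) \<le> real (card X) ^ 3" by (metis of_nat_le_iff of_nat_power)
  moreover have "1 \<le> real (card V)" using cardV X2 by simp
  ultimately have "0 \<le> log 2 (real (card V))" and "log 2 (real (card V)) \<le> log 2 (real (card X) ^ 3)"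
    by (simp, intro log_mono) auto
  then have "log 2 (real (card V)) \<le> 3 * log 2 (real (card X))" "0 \<le> log 2 (real (card V))"
    using X2 by (simp_all add: log_nat_power)
  moreover have "real (card V) \<le> real (card X) + 2 * real k * real (card X) / d"
    using card_heavy_le[OF d] cardV by simp
  ultimately have "real (card V) * log 2 (real (card V))
      \<le> (real (card X) + 2 * real k * real (card X) / d) * (3 * log 2 (real (card X)))"
    using d by (intro mult_mono) auto
  also have "\<dots> = 3 * (real (card X) + 2 * real k * real (card X) / d) * log 2 (real (card X))"
    by (simp only: mult_ac)
  finally show ?thesis using main by linarith
qed

text \<open>\<open>M\<close> is the mass that remains after deleting all triples that contain a heavy pair.\<close>

lemma light_part_bound:
  assumes l: "0 < l" and d: "0 < d" and X2: "2 \<le> card X"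
  defines "m \<equiv> real (card X)"
  obtains M where "mass - 9 * (m + 2 * real k * m / d) * log 2 m \<le> M"
    and "real l * (M * (M / m - 2) / 2) \<le> 16 * (2 * d + (real l)\<^sup>2 * (4 * real k) / m) * m\<^sup>2 * log 2 m"
proof -
  let ?P = "heavy d"
  \<comment> \<open>Testing all three pairs keeps the symmetry of \<open>T\<close>. In
    \<open>L\<close> a heavy pair has codegree zero and any other pair at most \<open>d\<close>, so
    \<open>light_bound\<close> applies.\<close>
  define L where "L j x y z = T j x y z * of_bool ((x, y) \<notin> ?P \<and> (y, z) \<notin> ?P \<and> (x, z) \<notin> ?P)" for j x y z
  have L0: "0 \<le> L j x y z" and LT: "L j x y z \<le> T j x y z" for j x y z
    using nonneg by (auto simp: L_def)
  have P_sym: "(x, y) \<in> ?P \<longleftrightarrow> (y, x) \<in> ?P" for x y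
    unfolding heavy_def by (auto simp: codeg_sym)
  interpret L: triple_system L X k c
  proof
    show "L j x y z = L j y x z" for j x y z
      unfolding L_def swap12[of j x y z] using P_sym[of x y] by (intro arg_cong2[where f = "(*)"] refl arg_cong[where f = of_bool]) blast
    show "L j x y z = L j x z y" for j x y z
      unfolding L_def swap23[of j x y z] using P_sym[of y z] by (intro arg_cong2[where f = "(*)"] refl arg_cong[where f = of_bool]) blast
    show "(\<Sum>y\<in>X. \<Sum>z\<in>X. L j x y z) \<le> 2" if "j < k" "x \<in> X" for j x
      using degree_le[OF that] by (rule order_trans[rotated]) (intro sum_mono LT)
    show "(\<Sum>z\<in>X. L j x y z) \<le> 1" if "j < k" "x \<in> X" "y \<in> X" for j x y
      using third_le[OF that] by (rule order_trans[rotated]) (intro sum_mono LT)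
    show "c x i + c y i + c z i = of_bool (i = j)" if "j < k" "L j x y z \<noteq> 0" "i < k" for j x y z i
      using decode[of j x y z i] that by (auto simp: L_def)
  qed (rule finite_X X_nonempty L0)+
  have "L.codeg x y \<le> d" if "x \<in> X" "y \<in> X" for x y
  proof (cases "(x, y) \<in> ?P")
    case True
    then show ?thesis using d by (simp add: L.codeg_def L_def)
  next
    case False
    have "L.codeg x y \<le> codeg x y" unfolding L.codeg_def codeg_def by (intro sum_mono LT)
    with False show ?thesis using that by (auto simp: heavy_def)
  qed
  then have "real l * (L.mass * (L.mass / m - 2) / 2) \<le> 16 * (2 * d + (real l)\<^sup>2 * (4 * real k) / m) * m\<^sup>2 * log 2 m"
    unfolding m_def by (intro L.light_bound l d)
  moreover have "mass - 9 * (m + 2 * real k * m / d) * log 2 m \<le> L.mass"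
  proof -
    \<comment> \<open>By symmetry a heavy pair in any of the three positions accounts for the same
      weight \<open>h j\<close>; with the factor \<open>3\<close> of \<open>heavy_mass_le\<close>
      this makes the \<open>9\<close>.\<close>
    define h where "h j = (\<Sum>x\<in>X. \<Sum>y\<in>X. \<Sum>z\<in>X. T j x y z * of_bool ((x, y) \<in> ?P))" for j
    have h1: "(\<Sum>x\<in>X. \<Sum>y\<in>X. \<Sum>z\<in>X. T j x y z * of_bool ((y, z) \<in> ?P)) = h j" for j
    proof -
      have "(\<Sum>x\<in>X. \<Sum>y\<in>X. \<Sum>z\<in>X. T j x y z * of_bool ((y, z) \<in> ?P))
         = (\<Sum>y\<in>X. \<Sum>z\<in>X. \<Sum>x\<in>X. T j x y z * of_bool ((y, z) \<in> ?P))"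
        by (subst sum.swap, intro sum.cong refl sum.swap)
      also have "\<dots> = (\<Sum>y\<in>X. \<Sum>z\<in>X. \<Sum>x\<in>X. T j y z x * of_bool ((y, z) \<in> ?P))"
        by (intro sum.cong refl arg_cong2[where f = "(*)"] rotate)
      finally show ?thesis by (simp add: h_def)
    qed
    have h2: "(\<Sum>x\<in>X. \<Sum>y\<in>X. \<Sum>z\<in>X. T j x y z * of_bool ((x, z) \<in> ?P)) = h j" for j
      unfolding h_def
      by (rule sum.cong[OF refl], subst sum.swap, intro sum.cong refl arg_cong2[where f = "(*)"] swap23)
    have h3: "h j = (\<Sum>(x, y)\<in>?P. \<Sum>z\<in>X. T j x y z)" for j
    proof -
      have "h j = (\<Sum>p\<in>X \<times> X. if p \<in> ?P then \<Sum>z\<in>X. T j (fst p) (snd p) z else 0)"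
        unfolding h_def by (auto simp: sum.cartesian_product' intro!: sum.cong)
      also have "\<dots> = (\<Sum>p\<in>(X \<times> X) \<inter> ?P. \<Sum>z\<in>X. T j (fst p) (snd p) z)"
        using finite_X by (simp add: sum.If_cases)
      finally show ?thesis using heavy_subset[of d] by (simp add: Int_absorb1 case_prod_unfold)
    qed
    have "T j x y z \<le> L j x y z + T j x y z * of_bool ((x, y) \<in> ?P)
        + T j x y z * of_bool ((y, z) \<in> ?P) + T j x y z * of_bool ((x, z) \<in> ?P)" for j x y z
      using nonneg[of j x y z] by (auto simp: L_def)
    then have le: "(\<Sum>x\<in>X. \<Sum>y\<in>X. \<Sum>z\<in>X. T j x y z) \<le> (\<Sum>x\<in>X. \<Sum>y\<in>X. \<Sum>z\<in>X. L j x y z + T j x y z * of_bool ((x, y) \<in> ?P)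
        + T j x y z * of_bool ((y, z) \<in> ?P) + T j x y z * of_bool ((x, z) \<in> ?P))" for j
      by (intro sum_mono)
    have "(\<Sum>x\<in>X. deg j x) \<le> (\<Sum>x\<in>X. L.deg j x) + 3 * h j" for j
      using le[of j] unfolding sum.distrib h1 h2 by (simp add: deg_def L.deg_def h_def)
    then have "(\<Sum>j<k. \<Sum>x\<in>X. deg j x) \<le> (\<Sum>j<k. (\<Sum>x\<in>X. L.deg j x) + 3 * h j)" by (rule sum_mono)
    then have "mass \<le> L.mass + 3 * (\<Sum>j<k. h j)"
      unfolding mass_def L.mass_def by (subst (1 2) sum.swap) (simp add: sum.distrib sum_distrib_left)
    moreover have "(\<Sum>j<k. h j) \<le> 3 * (m + 2 * real k * m / d) * log 2 m"
      unfolding h3 m_def by (rule heavy_mass_le[OF d X2])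
    ultimately show ?thesis by linarith
  qed
  ultimately show ?thesis using that by blast
qed

text \<open>The three cases: few colours, tuples of length \<open>1\<close>, and the generic choice of \<open>l\<close>.\<close>

lemma number_of_colours_cases:
  assumes \<delta>: "0 < \<delta>" and k: "0 < k" and X2: "2 \<le> card X"
    and mass: "6 * \<delta> * real k * real (card X) \<le> mass"
  defines "m \<equiv> real (card X)" and "lg \<equiv> log 2 (real (card X))"
  shows "\<delta> * real k \<le> 6 * lg \<or> \<delta>\<^sup>2 * real k \<le> 32 * lg \<or> \<delta> ^ 5 * real k ^ 3 \<le> 110592 * m * lg ^ 3"
proof (cases "\<delta> * real k \<le> 6 * lg")
  case False
  define K where "K = real k"
  \<comment> \<open>With this \<open>d\<close> the loss \<open>18 * K * m / d * lg\<close> equals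
    \<open>3 / 2 * \<delta> * K * m\<close>. The other loss \<open>9 * m * lg\<close> is no larger,
    because \<open>6 * lg < \<delta> * K\<close>. So at least \<open>3 * \<delta> * K * m\<close>
    survives.\<close>
  define d where "d = 12 * lg / \<delta>"
  have K: "0 < K" using k by (simp add: K_def)
  have m: "2 \<le> m" using X2 by (simp add: m_def)
  have "log 2 2 \<le> log 2 m" using m by (subst log_le_cancel_iff) auto
  then have \<lambda>: "1 \<le> lg" by (simp add: lg_def m_def)
  have d: "0 < d" using \<lambda> \<delta> by (simp add: d_def)
  have big: "6 * lg < \<delta> * K" using False by (simp add: K_def)
  have step: "3 * real l * \<delta>\<^sup>2 * K\<^sup>2 \<le> 32 * m * d * lg + 64 * K * (real l)\<^sup>2 * lg" if l: "0 < l" for l :: nat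
  proof -
    obtain M where M1: "mass - 9 * (m + 2 * K * m / d) * lg \<le> M"
      and M2: "real l * (M * (M / m - 2) / 2) \<le> 16 * (2 * d + (real l)\<^sup>2 * (4 * K) / m) * m\<^sup>2 * lg"
      using light_part_bound[OF l d X2] unfolding m_def lg_def K_def by blast
    have "9 * (m + 2 * K * m / d) * lg = 9 * m * lg + 3 / 2 * m * \<delta> * K"
      using \<lambda> \<delta> by (simp add: d_def field_simps)
    also have "9 * m * lg \<le> 3 / 2 * m * (\<delta> * K)"
      using mult_left_mono[of "6 * lg" "\<delta> * K" "3 / 2 * m"] big m by simp
    finally have "9 * (m + 2 * K * m / d) * lg \<le> 3 * \<delta> * K * m" by (simp add: mult_ac)
    then have M: "3 * (\<delta> * K) * m \<le> M" using M1 mass by (simp add: K_def m_def algebra_simps)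
    then have q: "3 * (\<delta> * K) \<le> M / m" using m by (simp add: field_simps)
    have "0 \<le> 3 * (\<delta> * K) * m" using \<delta> K m by simp
    then have "0 \<le> M" using M by linarith
    \<comment> \<open>Since \<open>\<delta> * K > 6\<close>, the subtracted \<open>2\<close> costs
      at most one of the three copies of \<open>\<delta> * K\<close>.\<close>
    then have "3 * (\<delta> * K) * m * (2 * (\<delta> * K)) \<le> M * (M / m - 2)"
      using M q big \<lambda> m \<delta> K by (intro mult_mono) auto
    then have "real l * (3 * (\<delta> * K) * m * (2 * (\<delta> * K)) / 2) \<le> real l * (M * (M / m - 2) / 2)"
      by (intro mult_left_mono divide_right_mono) auto
    also note M2
    also have "16 * (2 * d + (real l)\<^sup>2 * (4 * K) / m) * m\<^sup>2 * lg
        = (32 * m * d * lg + 64 * K * (real l)\<^sup>2 * lg) * m"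
      using m by (simp add: field_simps power2_eq_square)
    also have "real l * (3 * (\<delta> * K) * m * (2 * (\<delta> * K)) / 2) = (3 * real l * \<delta>\<^sup>2 * K\<^sup>2) * m"
      by (simp add: power2_eq_square)
    finally show ?thesis using m by simp
  qed
  show ?thesis
  proof (cases "K \<le> m * d")
    case True
    \<comment> \<open>This value balances the terms \<open>m * d\<close> and \<open>K * l^2\<close>
      in \<open>step\<close>. As \<open>1 \<le> s\<close>, rounding up at most doubles it.\<close>
    define s where "s = sqrt (m * d / K)"
    define l where "l = nat \<lceil>s\<rceil>"
    have s: "1 \<le> s" using True K by (simp add: s_def)
    have s2: "s\<^sup>2 * K = m * d" using m d K by (simp add: s_def)
    have l: "0 < l" "s \<le> real l" "real l \<le> 2 * s" using s unfolding l_def by linarith+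
    have "K * (real l)\<^sup>2 \<le> K * (2 * s)\<^sup>2" using l K s by (intro mult_left_mono power_mono) auto
    also have "\<dots> = 4 * (m * d)" using s2 by (simp add: power_mult_distrib mult_ac)
    finally have "64 * lg * (K * (real l)\<^sup>2) \<le> 64 * lg * (4 * (m * d))"
      using \<lambda> by (intro mult_left_mono) auto
    then have "3 * real l * \<delta>\<^sup>2 * K\<^sup>2 \<le> 288 * m * d * lg"
      using step[OF l(1)] by (simp add: mult_ac)
    moreover have "s * (\<delta>\<^sup>2 * K\<^sup>2) \<le> real l * (\<delta>\<^sup>2 * K\<^sup>2)"
      using l by (intro mult_right_mono) auto
    ultimately have "s * (\<delta>\<^sup>2 * K\<^sup>2) \<le> 96 * m * d * lg" by (simp add: mult_ac)
    \<comment> \<open>Squaring removes the root, and \<open>s^2 * K = m * d\<close> then cancels one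
      factor \<open>m * d\<close> on the right.\<close>
    then have "(s * (\<delta>\<^sup>2 * K\<^sup>2))\<^sup>2 \<le> (96 * m * d * lg)\<^sup>2"
      using s by (intro power_mono) auto
    moreover have "(s * (\<delta>\<^sup>2 * K\<^sup>2))\<^sup>2 = (s\<^sup>2 * K) * (\<delta> ^ 4 * K ^ 3)"
      by (simp add: power_mult_distrib power2_eq_square power3_eq_cube power4_eq_xxxx mult_ac)
    moreover have "(96 * m * d * lg)\<^sup>2 = (m * d) * (9216 * m * d * lg\<^sup>2)"
      by (simp add: power2_eq_square mult_ac)
    ultimately have "(m * d) * (\<delta> ^ 4 * K ^ 3) \<le> (m * d) * (9216 * m * d * lg\<^sup>2)"
      unfolding s2 by simp
    then have "\<delta> ^ 4 * K ^ 3 \<le> 9216 * m * d * lg\<^sup>2" using m d by simp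
    then have "\<delta> * (\<delta> ^ 4 * K ^ 3) \<le> \<delta> * (9216 * m * d * lg\<^sup>2)" using \<delta> by (intro mult_left_mono) auto
    moreover have "\<delta> * (9216 * m * d * lg\<^sup>2) = 110592 * m * lg ^ 3"
      using \<delta> by (simp add: d_def power2_eq_square power3_eq_cube)
    moreover have "\<delta> * (\<delta> ^ 4 * K ^ 3) = \<delta> ^ 5 * K ^ 3"
      by (simp add: numeral_eq_Suc)
    ultimately have "\<delta> ^ 5 * K ^ 3 \<le> 110592 * m * lg ^ 3" by linarith
    then show ?thesis by (simp add: K_def)
  next
    case False
    \<comment> \<open>Here the balancing value would be below \<open>1\<close>, so
      \<open>l = 1\<close> is used; \<open>m * d < K\<close> merges the two terms of
      \<open>step\<close> into \<open>32 + 64 = 96\<close>.\<close>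
    then have "32 * lg * (m * d) \<le> 32 * lg * K" using \<lambda> by (intro mult_left_mono) auto
    then have "3 * \<delta>\<^sup>2 * K\<^sup>2 \<le> 96 * K * lg" using step[of 1] by (simp add: mult_ac)
    then have "(3 * K) * (\<delta>\<^sup>2 * K) \<le> (3 * K) * (32 * lg)" by (simp add: power2_eq_square mult_ac)
    then have "\<delta>\<^sup>2 * K \<le> 32 * lg" using K by (simp add: mult_ac)
    then show ?thesis by (simp add: K_def)
  qed
qed simp

end

section \<open>Matchings of triples\<close>

definition triple_indicator :: "nat set set \<Rightarrow> nat \<Rightarrow> nat \<Rightarrow> nat \<Rightarrow> real" where
  "triple_indicator H x y z = of_bool ({x, y, z} \<in> H)"

lemma matching_distinct:
  assumes "hypergraph_matching 3 n H" "{x, y, z} \<in> H"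
  shows "x \<noteq> y" "x \<noteq> z" "y \<noteq> z"
proof -
  have "card {x, y, z} = 3" using assms by (auto simp: hypergraph_matching_def)
  then show "x \<noteq> y" "x \<noteq> z" "y \<noteq> z" by (auto simp: card_insert_if split: if_splits)
qed

lemma sum_triple:
  fixes h :: "'a \<Rightarrow> 'b::comm_monoid_add"
  assumes "x \<noteq> y" "x \<noteq> z" "y \<noteq> z"
  shows "(\<Sum>v\<in>{x, y, z}. h v) = h x + h y + h z"
  using assms by (simp add: add.assoc)

lemma matching_eqI:
  assumes "hypergraph_matching q n H" "e \<in> H" "f \<in> H" "x \<in> e" "x \<in> f"
  shows "e = f"
  using assms unfolding hypergraph_matching_def pairwise_def disjnt_def by blast

text \<open>Disjointness leaves at most one triple through \<open>x\<close>, and its other two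
  elements can be listed in two orders.\<close>

lemma triple_indicator_degree_le:
  assumes H: "hypergraph_matching 3 n H" and X: "finite X"
  shows "(\<Sum>y\<in>X. \<Sum>z\<in>X. triple_indicator H x y z) \<le> 2"
proof -
  define S where "S = (X \<times> X) \<inter> {p. {x, fst p, snd p} \<in> H}"
  have "card S \<le> 2"
  proof (cases "S = {}")
    case False
    then obtain t where "t \<in> S" by blast
    then have pq: "{x, fst t, snd t} \<in> H" by (simp add: S_def)
    have "s \<in> {t, prod.swap t}" if "s \<in> S" for s
    proof -
      have s: "{x, fst s, snd s} \<in> H" using that by (simp add: S_def)
      have eq: "{x, fst s, snd s} = {x, fst t, snd t}"
        by (rule matching_eqI[OF H s pq, of x]) simp_all
      have "fst s \<in> {x, fst t, snd t}" "snd s \<in> {x, fst t, snd t}"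
        unfolding eq[symmetric] by simp_all
      then show ?thesis
        using matching_distinct[OF H s] by (cases s; cases t) auto
    qed
    then have "S \<subseteq> {t, prod.swap t}" by blast
    then have "card S \<le> card {t, prod.swap t}" by (intro card_mono) auto
    also have "\<dots> \<le> 2" by (simp add: card_insert_if)
    finally show ?thesis .
  qed simp
  moreover have "(\<Sum>y\<in>X. \<Sum>z\<in>X. triple_indicator H x y z) = real (card S)"
    unfolding S_def triple_indicator_def sum.cartesian_product case_prod_unfold
    by (rule sum_of_bool_eq) (simp_all add: X)
  ultimately show ?thesis by simp
qed

text \<open>Triples that share \<open>x\<close> coincide, and the element other than
  \<open>x\<close> and \<open>y\<close> is then determined.\<close>

lemma triple_indicator_third_le:
  assumes H: "hypergraph_matching 3 n H" and X: "finite X"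
  shows "(\<Sum>z\<in>X. triple_indicator H x y z) \<le> 1"
proof -
  have "z = z'" if "{x, y, z} \<in> H" "{x, y, z'} \<in> H" for z z'
  proof -
    have eq: "{x, y, z} = {x, y, z'}" by (rule matching_eqI[OF H that, of x]) auto
    have "z \<in> {x, y, z'}" unfolding eq[symmetric] by simp
    then show ?thesis using matching_distinct[OF H that(1)] by auto
  qed
  then have "card (X \<inter> {z. {x, y, z} \<in> H}) \<le> Suc 0"
    using X by (subst card_le_Suc0_iff_eq) auto
  moreover have "(\<Sum>z\<in>X. triple_indicator H x y z) = real (card (X \<inter> {z. {x, y, z} \<in> H}))"
    unfolding triple_indicator_def by (rule sum_of_bool_eq) (simp_all add: X)
  ultimately show ?thesis by simp
qed

text \<open>The \<open>6\<close> is the number of orderings of one triple.\<close>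

lemma triple_indicator_mass_ge:
  assumes H: "hypergraph_matching 3 n H"
  shows "6 * real (card H) \<le> (\<Sum>x<n. \<Sum>y<n. \<Sum>z<n. triple_indicator H x y z)"
proof -
  let ?X = "{..<n}"
  have finH: "finite H" using H by (intro finite_subset[of H "Pow ?X"]) (auto simp: hypergraph_matching_def)
  have "6 \<le> (\<Sum>t\<in>?X \<times> ?X \<times> ?X. of_bool ({fst t, fst (snd t), snd (snd t)} = e) :: real)" if "e \<in> H" for e
  proof -
    have "card e = 3" "e \<subseteq> ?X" using H that by (auto simp: hypergraph_matching_def)
    then obtain p q r where e: "e = {p, q, r}" "p \<noteq> q" "p \<noteq> r" "q \<noteq> r" "p < n" "q < n" "r < n"
      by (auto simp: card_3_iff)
    let ?S = "{(p, q, r), (p, r, q), (q, p, r), (q, r, p), (r, p, q), (r, q, p)}"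
    have perm: "{fst t, fst (snd t), snd (snd t)} = e" if "t \<in> ?S" for t
      using that unfolding e(1) by (elim insertE) auto
    have "card ?S = 6" using e(2-4) by simp
    then have "6 = (\<Sum>t\<in>?S. 1 :: real)" unfolding sum_constant by linarith
    also have "\<dots> = (\<Sum>t\<in>?S. of_bool ({fst t, fst (snd t), snd (snd t)} = e))"
      by (rule sum.cong[OF refl], subst perm) simp_all
    also have "\<dots> \<le> (\<Sum>t\<in>?X \<times> ?X \<times> ?X. of_bool ({fst t, fst (snd t), snd (snd t)} = e))"
      using e by (intro sum_mono2) auto
    finally show ?thesis .
  qed
  then have "(\<Sum>e\<in>H. 6) \<le> (\<Sum>e\<in>H. \<Sum>t\<in>?X \<times> ?X \<times> ?X. of_bool ({fst t, fst (snd t), snd (snd t)} = e) :: real)"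
    by (rule sum_mono)
  also have "\<dots> = (\<Sum>t\<in>?X \<times> ?X \<times> ?X. \<Sum>e\<in>H. of_bool ({fst t, fst (snd t), snd (snd t)} = e))"
    by (rule sum.swap)
  also have "\<dots> = (\<Sum>t\<in>?X \<times> ?X \<times> ?X. triple_indicator H (fst t) (fst (snd t)) (snd (snd t)))"
    using finH by (intro sum.cong refl) (simp add: triple_indicator_def of_bool_def sum.delta)
  also have "\<dots> = (\<Sum>x<n. \<Sum>y<n. \<Sum>z<n. triple_indicator H x y z)"
    by (simp add: sum.cartesian_product')
  finally show ?thesis by simp
qed

section \<open>From the code to the lower bound on its length\<close>

theorem corollaryB4:
  shows "\<exists>\<kappa>::real. \<kappa> > 0 \<and>
    (\<forall>(k::nat) (n::nat) (\<delta>::real) (C :: bit vec \<Rightarrow> bit vec).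
       k \<ge> 2 \<longrightarrow> n \<ge> 1 \<longrightarrow> \<delta> > 0 \<longrightarrow> linear_LDC 3 \<delta> k n C \<longrightarrow>
       real n \<ge> \<kappa> * (\<delta> ^ 6 * real k ^ 3 / (log 2 (real k)) ^ 4))"
\<comment> \<open>\<open>10 ^ 7\<close> exceeds both constants that arise below,
  \<open>96^3 = 884736\<close> and \<open>27 * 110592 = 2985984\<close>.\<close>
proof (intro exI[of _ "1 / 10 ^ 7"] conjI allI impI)
  fix k n :: nat and \<delta> :: real and C :: "bit vec \<Rightarrow> bit vec"
  assume k: "2 \<le> k" and n: "1 \<le> n" and \<delta>: "0 < \<delta>" and LDC: "linear_LDC 3 \<delta> k n C"
  from LDC obtain H where match: "\<And>i. i < k \<Longrightarrow> hypergraph_matching 3 n (H i)"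
    and size: "\<And>i. i < k \<Longrightarrow> \<delta> * real n \<le> real (card (H i))"
    and dec: "\<And>i e b. i < k \<Longrightarrow> e \<in> H i \<Longrightarrow> b \<in> carrier_vec k \<Longrightarrow> (\<Sum>v\<in>e. C b $ v) = b $ i"
    unfolding linear_LDC_def by blast
  define L where "L = log 2 (real k)"
  define N where "N = log 2 (real n)"
  define K where "K = real k"
  have "log 2 2 \<le> log 2 (real k)" using k by (subst log_le_cancel_iff) auto
  then have L: "1 \<le> L" by (simp add: L_def)
  have K: "0 < K" using k by (simp add: K_def)
  \<comment> \<open>The vector of a position \<open>v\<close> lists the values at \<open>v\<close>
    of the codewords of the unit vectors. The locale's \<open>decode\<close> is the local decoding
    identity for the message \<open>unit_vec k i\<close>, whose bit \<open>j\<close> is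
    \<open>of_bool (i = j)\<close>.\<close>
  interpret triple_system "\<lambda>j. triple_indicator (H j)" "{..<n}" k "\<lambda>v i. C (unit_vec k i) $ v"
  proof
    show "finite {..<n}" "{..<n} \<noteq> {}" using n by (auto simp: lessThan_empty_iff)
    show "0 \<le> triple_indicator (H j) x y z" for j x y z by (simp add: triple_indicator_def)
    show "triple_indicator (H j) x y z = triple_indicator (H j) y x z"
      "triple_indicator (H j) x y z = triple_indicator (H j) x z y" for j x y z
      by (simp_all add: triple_indicator_def insert_commute)
    show "(\<Sum>y<n. \<Sum>z<n. triple_indicator (H j) x y z) \<le> 2" if "j < k" for j x
      by (rule triple_indicator_degree_le[OF match[OF that]]) simp
    show "(\<Sum>z<n. triple_indicator (H j) x y z) \<le> 1" if "j < k" for j x y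
      by (rule triple_indicator_third_le[OF match[OF that]]) simp
    show "C (unit_vec k i) $ x + C (unit_vec k i) $ y + C (unit_vec k i) $ z = of_bool (i = j)"
      if "j < k" "triple_indicator (H j) x y z \<noteq> 0" "i < k" for j x y z i
    proof -
      have e: "{x, y, z} \<in> H j" using that(2) by (simp add: triple_indicator_def split: if_splits)
      have "C (unit_vec k i) $ x + C (unit_vec k i) $ y + C (unit_vec k i) $ z
          = (\<Sum>v\<in>{x, y, z}. C (unit_vec k i) $ v)"
        by (rule sum_triple[symmetric]) (rule matching_distinct[OF match[OF that(1)] e])+
      also have "\<dots> = unit_vec k i $ j"
        by (rule dec[OF that(1) e]) simp
      also have "\<dots> = of_bool (i = j)" using that by auto
      finally show ?thesis .
    qed
  qed
  have "6 * \<delta> * K * real n = (\<Sum>j<k. 6 * (\<delta> * real n))" by (simp add: K_def)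
  also have "\<dots> \<le> (\<Sum>j<k. 6 * real (card (H j)))" using size by (intro sum_mono) auto
  also have "\<dots> \<le> (\<Sum>j<k. \<Sum>x<n. deg j x)"
    unfolding deg_def by (intro sum_mono triple_indicator_mass_ge match) auto
  also have "\<dots> = mass" unfolding mass_def by (rule sum.swap)
  finally have mass: "6 * \<delta> * K * real n \<le> mass" .
  \<comment> \<open>Comparison with the trivial upper bound on \<open>mass\<close> gives
    \<open>\<delta> \<le> 1 / 3\<close>, so that powers of \<open>\<delta>\<close> may be raised
    later.\<close>
  then have "(2 * K * real n) * (3 * \<delta>) \<le> (2 * K * real n) * 1"
    using mass_le by (simp add: K_def mult_ac)
  moreover have "0 < 2 * K * real n" using K n by simp
  ultimately have "3 * \<delta> \<le> 1" by (rule mult_le_cancel_left_pos[THEN iffD1, rotated])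
  then have \<delta>1: "\<delta> \<le> 1" by simp
  have n2: "2 \<le> n"
  proof -
    have "0 < \<delta> * real n" using \<delta> n by simp
    then have "0 < card (H 0)" using size[of 0] k by linarith
    then obtain e where "e \<in> H 0" by (auto simp: card_gt_0_iff)
    then have "card e = 3" "e \<subseteq> {..<n}" using match[of 0] k by (auto simp: hypergraph_matching_def)
    then have "3 \<le> n" using card_mono[of "{..<n}" e] by simp
    then show ?thesis by simp
  qed
  \<comment> \<open>If \<open>k ^ 3 \<le> n\<close> the bound is immediate; otherwise
    \<open>log 2 n \<le> 3 * log 2 k\<close>, which trades logarithms of \<open>n\<close> for those
    of \<open>k\<close>.\<close>
  have "\<delta> ^ 6 * K ^ 3 \<le> 10 ^ 7 * real n * L ^ 4"
  proof (cases "k ^ 3 \<le> n")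
    case True
    have "\<delta> ^ 6 * K ^ 3 \<le> 1 * real n"
      using True \<delta> \<delta>1 K by (intro mult_mono power_le_one) (auto simp: K_def)
    also have "\<dots> \<le> (10 ^ 7 * real n) * 1" by simp
    also have "\<dots> \<le> (10 ^ 7 * real n) * L ^ 4" using L by (intro mult_left_mono one_le_power) auto
    finally show ?thesis .
  next
    case False
    have "real n \<le> real k ^ 3" using False by simp
    then have "N \<le> log 2 (real k ^ 3)" unfolding N_def using n k by (subst log_le_cancel_iff) auto
    then have NL: "N \<le> 3 * L" using k by (simp add: L_def log_nat_power)
    have N0: "0 \<le> N" using n by (simp add: N_def)
    have n1: "1 \<le> real n" using n by simp
    have L34: "L ^ 3 \<le> L ^ 4" using L by (intro power_increasing) auto
    \<comment> \<open>The first two cases both end here: cubing produces the powers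
      \<open>\<delta> ^ 6\<close> and \<open>K ^ 3\<close>.\<close>
    have small: "\<delta> ^ 6 * K ^ 3 \<le> 10 ^ 7 * real n * L ^ 4" if "\<delta>\<^sup>2 * K \<le> 96 * L"
    proof -
      have "\<delta> ^ 6 * K ^ 3 = (\<delta>\<^sup>2 * K) ^ 3" 
        unfolding power_mult_distrib by (subst power_mult[symmetric]) simp
      also have "\<dots> \<le> (96 * L) ^ 3" using that K by (intro power_mono) auto
      also have "\<dots> = 884736 * 1 * L ^ 3" by (simp add: power_mult_distrib)
      also have "\<dots> \<le> 10 ^ 7 * real n * L ^ 4" using n1 L34 L by (intro mult_mono) auto
      finally show ?thesis .
    qed
    consider "\<delta> * K \<le> 6 * N" | "\<delta>\<^sup>2 * K \<le> 32 * N" | "\<delta> ^ 5 * K ^ 3 \<le> 110592 * real n * N ^ 3"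
      using number_of_colours_cases[of \<delta>] \<delta> k n2 mass by (auto simp: K_def N_def)
    then show ?thesis
    proof cases
      case 1
      have "\<delta>\<^sup>2 * K = \<delta> * (\<delta> * K)" by (simp add: power2_eq_square)
      also have "\<dots> \<le> 1 * (6 * N)" using 1 \<delta> \<delta>1 K by (intro mult_mono[of _ _ "\<delta> * K"]) auto
      finally show ?thesis using small NL L by linarith
    next
      case 2
      then show ?thesis using small NL by linarith
    next
      case 3
      \<comment> \<open>The generic case has \<open>\<delta> ^ 5\<close> and the cube of the
        logarithm; \<open>\<delta> \<le> 1\<close> and \<open>1 \<le> L\<close> bring both to the
        stated powers.\<close>
      have "\<delta> ^ 6 * K ^ 3 = \<delta> * (\<delta> ^ 5 * K ^ 3)" by (simp add: numeral_eq_Suc)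
      also have "\<dots> \<le> 1 * (\<delta> ^ 5 * K ^ 3)" using \<delta> \<delta>1 K by (intro mult_right_mono) auto
      also have "\<dots> \<le> 110592 * real n * N ^ 3" using 3 by simp
      also have "\<dots> \<le> 110592 * real n * (3 * L) ^ 3"
        using NL N0 by (intro mult_left_mono power_mono) auto
      also have "\<dots> = (2985984 * real n) * L ^ 3" by (simp add: power_mult_distrib)
      also have "\<dots> \<le> (10 ^ 7 * real n) * L ^ 4" using L34 L by (intro mult_mono) auto
      finally show ?thesis .
    qed
  qed
  moreover have "0 < L ^ 4" using L by simp
  ultimately have "\<delta> ^ 6 * K ^ 3 / L ^ 4 \<le> 10 ^ 7 * real n" by (simp add: pos_divide_le_eq)
  then show "1 / 10 ^ 7 * (\<delta> ^ 6 * real k ^ 3 / (log 2 (real k)) ^ 4) \<le> real n"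
    by (simp add: K_def L_def)
qed simp

end
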